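(* Let $n\ge1$. The logarithmic nonlinear Schrödinger equation with $\varepsilon=1$, $$iu_t+\Delta u=\log(|u|^2)\,u,\qquad (t,x)\in\mathbb{R}\times\mathbb{R}^n,$$ has no breather solution.
   Context: Breather (in the weak sense, which includes standing waves): a solution $u:\mathbb{R}\times\mathbb{R}^n\to\mathbb{C}$, not identically zero, for which there exist $\tau,C,\gamma>0$ and $\alpha^*\ge0$ such that: (i) $u(t+\tau,x)=u(t,x)$ for all $(t,x)\in\mathbb{R}\times\mathbb{R}^n$; (ii) $u(t,\cdot)\in C^\infty(\mathbb{R}^n)\cap H^1(\mathbb{R}^n)$ for all $t\in\mathbb{R}$; (iii) $\sup_{t\in\mathbb{R}}|D_x^\alpha u(t,x)|\le Ce^{-\gamma|x|}$ for all $x\in\mathbb{R}^n$ and all multi-indices $|\alpha|\le\alpha^*$. The nonlinearity $\log(|u|^2)u$ is understood to be $0$ where $u=0$. *)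

theory Defs
  imports "HOL-Analysis.Analysis"
begin

definition partial_deriv :: "'n \<Rightarrow> (real^'n::finite \<Rightarrow> complex) \<Rightarrow> real^'n \<Rightarrow> complex" where
  "partial_deriv i f x = vector_derivative (\<lambda>h. f (x + h *\<^sub>R axis i 1)) (at 0)"

fun iter_partial :: "'n list \<Rightarrow> (real^'n::finite \<Rightarrow> complex) \<Rightarrow> real^'n \<Rightarrow> complex" where
  "iter_partial [] f = f"
| "iter_partial (i # is) f = partial_deriv i (iter_partial is f)"

definition laplacian :: "(real^'n::finite \<Rightarrow> complex) \<Rightarrow> real^'n \<Rightarrow> complex" where
  "laplacian f x = (\<Sum>i\<in>UNIV. iter_partial [i, i] f x)"

text \<open>
  Total differentiability of every iterated partial derivative includes their existence and
  continuity, hence is \<open>C\<^sup>\<infinity>\<close>.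
\<close>

definition smooth :: "(real^'n::finite \<Rightarrow> complex) \<Rightarrow> bool" where
  "smooth f \<longleftrightarrow> (\<forall>is x. iter_partial is f differentiable (at x))"

definition test_fun :: "(real^'n::finite \<Rightarrow> complex) \<Rightarrow> bool" where
  "test_fun \<phi> \<longleftrightarrow> smooth \<phi> \<and> (\<exists>K. compact K \<and> (\<forall>x. x \<notin> K \<longrightarrow> \<phi> x = 0))"

definition locally_integrable :: "(real^'n::finite \<Rightarrow> complex) \<Rightarrow> bool" where
  "locally_integrable f \<longleftrightarrow> (\<forall>K. compact K \<longrightarrow> set_integrable lborel K f)"

definition in_L2 :: "(real^'n::finite \<Rightarrow> complex) \<Rightarrow> bool" where
  "in_L2 f \<longleftrightarrow> f \<in> borel_measurable lborel \<and> integrable lborel (\<lambda>x. (norm (f x))\<^sup>2)"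

definition weak_partial ::
  "'n \<Rightarrow> (real^'n::finite \<Rightarrow> complex) \<Rightarrow> (real^'n \<Rightarrow> complex) \<Rightarrow> bool" where
  "weak_partial i f g \<longleftrightarrow>
    (\<forall>\<phi>. test_fun \<phi> \<longrightarrow>
      (\<integral>x. f x * partial_deriv i \<phi> x \<partial>lborel) = - (\<integral>x. g x * \<phi> x \<partial>lborel))"

definition in_H1 :: "(real^'n::finite \<Rightarrow> complex) \<Rightarrow> bool" where
  "in_H1 f \<longleftrightarrow> in_L2 f \<and> (\<forall>i. \<exists>g. in_L2 g \<and> weak_partial i f g)"

definition log_nonlin :: "complex \<Rightarrow> complex" where
  "log_nonlin z = (if z = 0 then 0 else of_real (ln ((cmod z)\<^sup>2)) * z)"

text \<open>
  The time derivative is taken in the sense of distributions on \<open>\<real>\<^sup>n\<close>: the curve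
  \<open>t \<mapsto> u t\<close> is differentiable when tested against any test function.  This admits both
  classical solutions (see \<open>classical_imp_log_nls_solution\<close> below) and the finite-energy
  solutions, continuous in time with values in \<open>H\<^sup>1\<close>, whose time derivative is only a
  distribution in \<open>x\<close>.  The Laplacian is the classical one, since the time slices of a
  breather are smooth.
\<close>

definition weak_time_deriv ::
  "(real \<Rightarrow> real^'n::finite \<Rightarrow> complex) \<Rightarrow> (real \<Rightarrow> real^'n \<Rightarrow> complex) \<Rightarrow> bool" where
  "weak_time_deriv u ut \<longleftrightarrow>
    (\<forall>t. locally_integrable (u t) \<and> locally_integrable (ut t)) \<and>
    (\<forall>\<phi> t. test_fun \<phi> \<longrightarrow>
      ((\<lambda>s. \<integral>x. u s x * \<phi> x \<partial>lborel) has_vector_derivative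
        (\<integral>x. ut t x * \<phi> x \<partial>lborel)) (at t))"

definition log_nls_solution :: "(real \<Rightarrow> real^'n::finite \<Rightarrow> complex) \<Rightarrow> bool" where
  "log_nls_solution u \<longleftrightarrow>
    (\<exists>ut. weak_time_deriv u ut \<and>
      (\<forall>t x. \<i> * ut t x + laplacian (u t) x = log_nonlin (u t x)))"

text \<open>
  A list \<open>is\<close> of coordinate directions stands for the multi-index counting how often each
  direction occurs, so \<open>length is\<close> is its order; for smooth functions the order in which the
  derivatives are taken is immaterial.  The bound on the supremum over \<open>t\<close> is stated for
  every \<open>t\<close>.
\<close>

definition breather_profile :: "(real \<Rightarrow> real^'n::finite \<Rightarrow> complex) \<Rightarrow> bool" where
  "breather_profile u \<longleftrightarrow>
    (\<exists>t x. u t x \<noteq> 0) \<and>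
    (\<exists>\<tau> C \<gamma> :: real. \<exists>\<alpha>max :: nat. \<tau> > 0 \<and> C > 0 \<and> \<gamma> > 0 \<and>
      (\<forall>t x. u (t + \<tau>) x = u t x) \<and>
      (\<forall>t. smooth (u t) \<and> in_H1 (u t)) \<and>
      (\<forall>x is. length is \<le> \<alpha>max \<longrightarrow>
        (\<forall>t. cmod (iter_partial is (u t) x) \<le> C * exp (- \<gamma> * norm x))))"

lemma continuous_imp_locally_integrable:
  assumes "continuous_on UNIV f"
  shows "locally_integrable f"
  unfolding locally_integrable_def
  using assms borel_integrable_compact continuous_on_subset
  by (metis set_integrable_def subset_UNIV)

lemma test_fun_continuous:
  assumes "test_fun \<phi>"
  shows "continuous_on UNIV \<phi>"
proof -
  have "\<phi> differentiable (at x)" for x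
    using assms iter_partial.simps(1) unfolding test_fun_def smooth_def by metis
  then show ?thesis
    using differentiable_imp_continuous_within continuous_at_imp_continuous_on by blast
qed

lemma lborel_integral_eq_cbox:
  fixes f :: "real^'n::finite \<Rightarrow> complex"
  assumes f: "continuous_on UNIV f" and z: "\<And>x. x \<notin> cbox a b \<Longrightarrow> f x = 0"
  shows "(\<integral>x. f x \<partial>lborel) = integral (cbox a b) f"
proof -
  have e: "(\<lambda>x. indicat_real (cbox a b) x *\<^sub>R f x) = f"
    using z by (auto simp: indicator_def)
  have s: "set_integrable lborel (cbox a b) f"
    using continuous_imp_locally_integrable[OF f] by (simp add: locally_integrable_def)
  show ?thesis
    using set_borel_integral_eq_integral(2)[OF s] e
    by (simp add: set_lebesgue_integral_def)
qed

lemma classical_imp_log_nls_solution: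
  fixes u ut :: "real \<Rightarrow> real^'n::finite \<Rightarrow> complex"
  assumes u: "\<And>t. continuous_on UNIV (u t)"
    and ut: "continuous_on UNIV (\<lambda>(t, x). ut t x)"
    and deriv: "\<And>t x. ((\<lambda>s. u s x) has_vector_derivative ut t x) (at t)"
    and eq: "\<And>t x. \<i> * ut t x + laplacian (u t) x = log_nonlin (u t x)"
  shows "log_nls_solution u"
proof -
  have ut_slice: "continuous_on UNIV (ut t)" for t
    using continuous_on_compose2[OF ut, of UNIV "\<lambda>x. (t, x)"]
    by (simp add: continuous_on_Pair)
  have "((\<lambda>s. \<integral>x. u s x * \<phi> x \<partial>lborel) has_vector_derivative
          (\<integral>x. ut t x * \<phi> x \<partial>lborel)) (at t)" if \<phi>: "test_fun \<phi>" for \<phi> t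
  proof -
    obtain K where K: "compact K" "\<And>x. x \<notin> K \<Longrightarrow> \<phi> x = 0"
      using \<phi> by (auto simp: test_fun_def)
    obtain a b where ab: "K \<subseteq> cbox a b"
      using compact_imp_bounded[OF K(1)] bounded_subset_cbox_symmetric by metis
    have z: "\<phi> x = 0" if "x \<notin> cbox a b" for x
      using K(2) ab that by blast
    note c = test_fun_continuous[OF \<phi>]
    have *: "((\<lambda>s. integral (cbox a b) (\<lambda>x. u s x * \<phi> x)) has_vector_derivative
          integral (cbox a b) (\<lambda>x. ut t x * \<phi> x)) (at t within UNIV)"
    proof (rule leibniz_rule_vector_derivative)
      show "((\<lambda>s. u s x * \<phi> x) has_vector_derivative ut s x * \<phi> x) (at s within UNIV)" for s x
        using has_vector_derivative_mult_left[OF deriv] by simp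
      show "(\<lambda>x. u s x * \<phi> x) integrable_on cbox a b" for s
        by (intro integrable_continuous continuous_on_mult continuous_on_subset[OF u]
            continuous_on_subset[OF c]) auto
      have "continuous_on UNIV (\<lambda>p. ut (fst p) (snd p) * \<phi> (snd p))"
        using ut by (intro continuous_on_mult continuous_on_compose2[OF c] continuous_intros)
          (auto simp: case_prod_beta)
      then show "continuous_on (UNIV \<times> cbox a b) (\<lambda>(s, x). ut s x * \<phi> x)"
        by (auto simp: case_prod_beta intro: continuous_on_subset)
    qed auto
    have "(\<integral>x. u s x * \<phi> x \<partial>lborel) = integral (cbox a b) (\<lambda>x. u s x * \<phi> x)" for s
      by (rule lborel_integral_eq_cbox) (auto intro!: continuous_on_mult u c z)
    moreover have "(\<integral>x. ut t x * \<phi> x \<partial>lborel) = integral (cbox a b) (\<lambda>x. ut t x * \<phi> x)"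
      by (rule lborel_integral_eq_cbox) (auto intro!: continuous_on_mult ut_slice c z)
    ultimately show ?thesis
      using * by simp
  qed
  then have "weak_time_deriv u ut"
    by (simp add: weak_time_deriv_def continuous_imp_locally_integrable u ut_slice)
  then show ?thesis
    using eq by (auto simp: log_nls_solution_def)
qed

end

(*
  The contradiction comes from the virial identity.  For a solution of the equation the derivative
  of  Im \<integral> cnj u (x . grad u)  is  2 \<integral> |grad u|^2 + n \<integral> |u|^2 > 0,  which is incompatible with periodicity in time.  Only the values of u are known to decay
  uniformly in time, so the identity is applied to a spatial mollification v of u instead.  This
  produces the error term  Re \<integral> d (2 x . grad (cnj v) + n cnj v),  where d is the commutator of the
  mollification with the nonlinearity.  The positive term 2 |grad v|^2 absorbs the gradient in the
  error, and what remains is at least  n \<integral> |v|^2 - \<integral> (|x| |d|)^2 / 2 - n \<integral> |d| |v|,  which is bounded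
  below uniformly and tends to n \<integral> |u|^2 for each fixed time as the mollification is removed.
  Fatou's lemma over one period then forces u to vanish at almost all times.
*)
theory Submission
  imports Defs
begin

section \<open>Exponentially decaying families and differentiation under the integral\<close>

text \<open>The zero-order term n |u|^2 comes from the potential F(z) = |z|^2 ln |z|^2 - |z|^2:
  integrating x . grad by parts produces the combination Re (f(z) cnj z) - F(z), which equals |z|^2,
  so the logarithm cancels. The obstacle is uniformity. The gradient of a mollification may grow
  without bound as the radius shrinks, so a usable lower bound may contain only v, d and |x|. Both v
  and d decay exponentially with constants common to all times and all radii, and such decay absorbs
  the weight |x|; hence pointwise convergence of d to 0 suffices, without any rate for the
  commutator. Time enters through testing alone. Since a reflected and translated kernel is again a
  test function, v is differentiable in time at each fixed x and solves the equation with the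
  mollified nonlinearity. The same fact contradicts the outcome of Fatou's lemma: one mollification
  that is nonzero at a single point and time stays nonzero there for nearby times, so u does not
  vanish on a whole interval of times.\<close>

lemma summable_power_mult_exp:
  fixes c :: real assumes "c > 0"
  shows "summable (\<lambda>k. (2 * (real k + 1)) ^ m * exp (- c * real k))"
proof -
  let ?f = "\<lambda>k. (2 * (real k + 1)) ^ m * exp (- c * real k)"
  let ?r = "\<lambda>k. (1 + inverse (real (Suc k))) ^ m * exp (-c)"
  have eq: "?f (Suc k) = ?r k * ?f k" for k
  proof -
    have "exp (- c * real (Suc k)) = exp (-c) * exp (- c * real k)"
      by (simp add: exp_add[symmetric] algebra_simps)
    moreover have "2 * (real (Suc k) + 1) = (1 + inverse (real (Suc k))) * (2 * (real k + 1))"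
      by (simp add: field_simps)
    then have "(2 * (real (Suc k) + 1)) ^ m = (1 + inverse (real (Suc k))) ^ m * (2 * (real k + 1)) ^ m"
      by (metis power_mult_distrib)
    ultimately show ?thesis by simp
  qed
  have "?r \<longlonglongrightarrow> (1 + 0) ^ m * exp (-c)"
    by (intro tendsto_intros LIMSEQ_inverse_real_of_nat)
  \<comment> \<open>The midpoint of \<open>exp (-c)\<close> and 1 leaves room for the polynomial
    factor, whose successive ratios tend to 1.\<close>
  moreover have "(1 + 0) ^ m * exp (-c) < (1 + exp (-c)) / 2" using assms by simp
  ultimately have "eventually (\<lambda>k. ?r k < (1 + exp (-c)) / 2) sequentially"
    by (rule order_tendstoD)
  then obtain N where N: "\<And>k. k \<ge> N \<Longrightarrow> ?r k < (1 + exp (-c)) / 2"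
    unfolding eventually_sequentially by blast
  show ?thesis
  proof (rule summable_ratio_test)
    show "(1 + exp (-c)) / 2 < 1" using assms by simp
    fix k assume "k \<ge> N"
    then have "?r k * ?f k \<le> (1 + exp (-c)) / 2 * ?f k"
      using N[of k] by (intro mult_right_mono) auto
    moreover have "?f (Suc k) \<ge> 0" "?f k \<ge> 0" by auto
    ultimately show "norm (?f (Suc k)) \<le> (1 + exp (-c)) / 2 * norm (?f k)"
      unfolding eq[symmetric] real_norm_def by (simp only: abs_of_nonneg)
  qed
qed

text \<open>The shell k <= |x| < k + 1 lies in the cube of half-side k + 1, of volume (2 (k + 1))^n,
  so the integral is bounded by a series of a power times an exponential.\<close>

lemma integrable_exp_neg_norm:
  fixes c :: real assumes "c > 0"
  shows "integrable lborel (\<lambda>x::real^'n::finite. exp (- c * norm x))"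
proof (rule integrableI_bounded)
  let ?m = "CARD('n)"
  let ?B = "\<lambda>k. cbox (- (\<chi> i. real k + 1)) (\<chi> i. real k + 1) :: (real^'n) set"
  have pt: "ennreal (norm (exp (- c * norm x))) \<le> (\<Sum>k. ennreal (exp (- c * real k)) * indicator (?B k) x)" for x :: "real^'n"
  proof -
    define k where "k = nat \<lfloor>norm x\<rfloor>"
    have k: "real k \<le> norm x" "norm x < real k + 1"
      unfolding k_def by (auto simp: of_nat_nat)
    have "\<bar>x $ i\<bar> \<le> real k + 1" for i
      using component_le_norm_cart[of x i] k by linarith
    then have "- (real k + 1) \<le> x $ i \<and> x $ i \<le> real k + 1" for i
      unfolding abs_le_iff by (metis minus_le_iff)
    then have "x \<in> ?B k" by (simp add: mem_box_cart)
    then have "ennreal (norm (exp (- c * norm x))) \<le> ennreal (exp (- c * real k)) * indicator (?B k) x"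
      using k(1) assms by (auto intro!: ennreal_leI)
    also have "\<dots> \<le> (\<Sum>k. ennreal (exp (- c * real k)) * indicator (?B k) x)"
      using sum_le_suminf[OF summableI, of "{k}" "\<lambda>k. ennreal (exp (- c * real k)) * indicator (?B k) x"]
      by (simp only: finite.intros sum.insert sum.empty add_0_right simp_thms empty_iff UNIV_I subset_UNIV zero_le)
    finally show ?thesis .
  qed
  have em: "emeasure lborel (?B k) = ennreal ((2 * (real k + 1)) ^ ?m)" for k
  proof -
    have "measure lborel (?B k) = (2 * (real k + 1)) ^ ?m"
    proof -
      have "0 \<in> ?B k" by (simp add: mem_box_cart)
      then show ?thesis by (subst content_cbox_cart) auto
    qed
    then show ?thesis
      using emeasure_lborel_cbox_finite[of "- (\<chi> i. real k + 1)" "\<chi> i. real k + 1 :: real^'n"]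
      by (subst emeasure_eq_ennreal_measure) auto
  qed
  have "(\<integral>\<^sup>+x. ennreal (norm (exp (- c * norm (x::real^'n)))) \<partial>lborel) \<le>
     (\<integral>\<^sup>+x. (\<Sum>k. ennreal (exp (- c * real k)) * indicator (?B k) x) \<partial>lborel)"
    by (intro nn_integral_mono pt)
  also have "\<dots> = (\<Sum>k. \<integral>\<^sup>+x. ennreal (exp (- c * real k)) * indicator (?B k) x \<partial>lborel)"
    by (rule nn_integral_suminf) auto
  also have "\<dots> = (\<Sum>k. ennreal ((2 * (real k + 1)) ^ ?m * exp (- c * real k)))"
    by (subst nn_integral_cmult_indicator) (auto simp: em ennreal_mult[symmetric] mult.commute)
  also have "\<dots> < \<infinity>"
    unfolding infinity_ennreal_def less_top[symmetric]
    by (rule ennreal_suminf_neq_top[OF summable_power_mult_exp[OF assms]]) simp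
  finally show "(\<integral>\<^sup>+x. ennreal (norm (exp (- c * norm (x::real^'n)))) \<partial>lborel) < \<infinity>" .
qed simp

text \<open>One pair \<open>K\<close>, \<open>c\<close> serves all parameters \<open>p\<close>. The
  parameter is later a time or a pair of a time and a mollification index, so one exponential
  dominates the whole family.\<close>

definition decays :: "('p \<Rightarrow> 'a::real_normed_vector \<Rightarrow> 'b::real_normed_vector) \<Rightarrow> bool" where
  "decays F \<longleftrightarrow> (\<exists>K>0. \<exists>c>0. \<forall>p x. norm (F p x) \<le> K * exp (- c * norm x))"

lemma decaysI:
  assumes "c > 0" "\<And>p x. norm (F p x) \<le> K * exp (- c * norm x)"
  shows "decays F"
proof -
  have "norm (F p x) \<le> max K 1 * exp (- c * norm x)" for p x
    by (rule order_trans[OF assms(2)]) (auto intro!: mult_right_mono)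
  then show ?thesis unfolding decays_def using assms(1) by (intro exI[of _ "max K 1"] conjI exI[of _ c]) auto
qed

lemma decays_mono:
  assumes "decays F" "\<And>p x. norm (G p x) \<le> M * norm (F p x)"
  shows "decays G"
proof -
  obtain K c where *: "K > 0" "c > 0" "\<And>p x. norm (F p x) \<le> K * exp (- c * norm x)"
    using assms(1) unfolding decays_def by blast
  show ?thesis
  proof (rule decaysI[OF *(2), where K = "\<bar>M\<bar> * K"])
    fix p x
    have "norm (G p x) \<le> \<bar>M\<bar> * norm (F p x)"
      using assms(2)[of p x] by (meson abs_ge_self mult_right_mono norm_ge_zero order_trans)
    also have "\<dots> \<le> \<bar>M\<bar> * (K * exp (- c * norm x))"
      by (intro mult_left_mono *) auto
    finally show "norm (G p x) \<le> \<bar>M\<bar> * K * exp (- c * norm x)" by (simp add: mult.assoc)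
  qed
qed

lemma decays_add:
  assumes "decays F" "decays G"
  shows "decays (\<lambda>p x. F p x + G p x)"
proof -
  obtain K c where *: "K > 0" "c > 0" "\<And>p x. norm (F p x) \<le> K * exp (- c * norm x)"
    using assms(1) unfolding decays_def by blast
  obtain L d where **: "L > 0" "d > 0" "\<And>p x. norm (G p x) \<le> L * exp (- d * norm x)"
    using assms(2) unfolding decays_def by blast
  show ?thesis
  proof (rule decaysI[where c = "min c d" and K = "K + L"])
    fix p x
    have "norm (F p x + G p x) \<le> K * exp (- c * norm x) + L * exp (- d * norm x)"
      by (intro norm_triangle_mono * **)
    also have "\<dots> \<le> K * exp (- min c d * norm x) + L * exp (- min c d * norm x)"
      using * ** by (intro add_mono mult_left_mono) (auto intro!: mult_right_mono)
    finally show "norm (F p x + G p x) \<le> (K + L) * exp (- min c d * norm x)" by (simp add: algebra_simps)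
  qed (use * ** in auto)
qed

lemma decays_zero: "decays (\<lambda>p x. 0)"
  by (rule decaysI[where c = 1 and K = 0]) auto

lemma decays_sum:
  assumes "\<And>i. i \<in> I \<Longrightarrow> decays (F i)"
  shows "decays (\<lambda>p x. \<Sum>i\<in>I. F i p x)"
  using assms by (induction I rule: infinite_finite_induct) (auto intro: decays_add decays_zero)

lemma decays_bounded:
  assumes "decays F" obtains K where "K > 0" "\<And>p x. norm (F p x) \<le> K"
proof -
  obtain K c where *: "K > 0" "c > 0" "\<And>p x. norm (F p x) \<le> K * exp (- c * norm x)"
    using assms(1) unfolding decays_def by blast
  have "norm (F p x) \<le> K" for p x
  proof (rule order_trans[OF *(3)])
    show "K * exp (- c * norm x) \<le> K" using * by simp
  qed
  with * that show ?thesis by blast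
qed

lemma decays_mult:
  fixes F G :: "'p \<Rightarrow> 'a::real_normed_vector \<Rightarrow> 'b::real_normed_algebra"
  assumes "decays F" "decays G"
  shows "decays (\<lambda>p x. F p x * G p x)"
proof -
  obtain K where K: "K > 0" "\<And>p x. norm (F p x) \<le> K" using decays_bounded[OF assms(1)] by blast
  show ?thesis
    by (rule decays_mono[OF assms(2), of _ K])
      (auto intro!: order_trans[OF norm_mult_ineq] mult_right_mono K)
qed

text \<open>Half of the exponential rate pays for the weight, since c/2 |x| <= exp (c/2
  |x|).\<close>

lemma decays_norm_mult:
  assumes "decays F"
  shows "decays (\<lambda>p x. norm x * norm (F p x))"
proof -
  obtain K c where *: "K > 0" "c > 0" "\<And>p x. norm (F p x) \<le> K * exp (- c * norm x)"
    using assms(1) unfolding decays_def by blast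
  show ?thesis
  proof (rule decaysI[where c = "c/2" and K = "K * (2 / c)"])
    fix p and x :: 'b
    have "norm x * norm (F p x) \<le> norm x * (K * exp (- c * norm x))" by (intro mult_left_mono *) auto
    also have "\<dots> = K * (2/c) * (c/2 * norm x * exp (- c * norm x))" using * by simp
    finally have le: "norm x * norm (F p x) \<le> K * (2/c) * (c/2 * norm x * exp (- c * norm x))" .
    have "c / 2 * norm x \<le> exp (c/2 * norm x)" using exp_ge_add_one_self[of "c/2 * norm x"] by linarith
    then have "norm x * norm (F p x) \<le> K * (2/c) * (exp (c/2 * norm x) * exp (- c * norm x))"
      using * by (intro order_trans[OF le] mult_left_mono mult_right_mono) auto
    also have "exp (c/2 * norm x) * exp (- c * norm x) = exp (- (c/2) * norm x)"
      by (simp add: exp_add[symmetric])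
    finally show "norm (norm x * norm (F p x)) \<le> K * (2 / c) * exp (- (c / 2) * norm x)" by simp
  qed (use * in auto)
qed

lemma decays_coord:
  fixes F :: "'p \<Rightarrow> real^'n::finite \<Rightarrow> 'b::real_normed_vector"
  assumes "decays F"
  shows "decays (\<lambda>p x. (x $ i) *\<^sub>R F p x)"
  by (rule decays_mono[OF decays_norm_mult[OF assms], of _ 1])
    (auto intro!: mult_right_mono component_le_norm_cart)

lemma decays_coord_real:
  fixes F :: "'p \<Rightarrow> real^'n::finite \<Rightarrow> real"
  assumes "decays F"
  shows "decays (\<lambda>p x. (x $ i) * F p x)"
  using decays_coord[OF assms] by simp

lemma decays_cmult_real:
  fixes F :: "'p \<Rightarrow> 'a::real_normed_vector \<Rightarrow> real"
  shows "decays F \<Longrightarrow> decays (\<lambda>p x. c * F p x)"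
  by (erule decays_mono[of _ _ "\<bar>c\<bar>"]) (simp add: abs_mult)

lemma decays_diff:
  assumes "decays F" "decays G"
  shows "decays (\<lambda>p x. F p x - G p x)"
proof -
  have "decays (\<lambda>p x. - G p x)" by (rule decays_mono[OF assms(2), of _ 1]) simp
  from decays_add[OF assms(1) this] show ?thesis by simp
qed

lemma decays_Re_mult_cnj:
  assumes "decays F" "decays G"
  shows "decays (\<lambda>p x. Re (F p x * cnj (G p x)))"
  by (rule decays_mono[OF decays_mult[OF assms], of _ 1])
    (metis abs_Re_le_cmod complex_mod_cnj mult_1 norm_mult real_norm_def)

lemma decays_reparam: "decays F \<Longrightarrow> decays (\<lambda>q. F (h q))"
  unfolding decays_def by blast

lemma decays_integrable:
  fixes F :: "'p \<Rightarrow> real^'n::finite \<Rightarrow> 'b::{banach,second_countable_topology}"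
  assumes "decays F" "F p \<in> borel_measurable lborel"
  shows "integrable lborel (F p)"
proof -
  obtain K c where *: "K > 0" "c > 0" "\<And>p x. norm (F p x) \<le> K * exp (- c * norm x)"
    using assms(1) unfolding decays_def by blast
  show ?thesis
    by (rule Bochner_Integration.integrable_bound[OF integrable_mult_right[OF integrable_exp_neg_norm[OF *(2)], of K]])
      (use assms * in \<open>auto intro: order_trans[OF *(3)] simp del: mult_minus_left\<close>)
qed

section \<open>Differentiation under the integral sign and integrals of directional
  derivatives\<close>

lemma has_vector_derivative_iff_tendsto:
  fixes f :: "real \<Rightarrow> 'b::real_normed_vector"
  shows "(f has_vector_derivative D) (at t) \<longleftrightarrow>
    ((\<lambda>s. inverse (s - t) *\<^sub>R (f s - f t)) \<longlongrightarrow> D) (at t)"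
proof -
  have "norm ((1 / norm (s - t)) *\<^sub>R (f s - (f t + (s - t) *\<^sub>R D))) =
      norm (inverse (s - t) *\<^sub>R (f s - f t) - D)" if "s \<noteq> t" for s
  proof -
    have "inverse (s - t) *\<^sub>R (f s - f t) - D = inverse (s - t) *\<^sub>R (f s - (f t + (s - t) *\<^sub>R D))"
      using that by (simp add: scaleR_right_diff_distrib scaleR_right_distrib)
    then show ?thesis by (simp add: divide_inverse abs_inverse)
  qed
  then have "((\<lambda>s. norm ((1 / norm (s - t)) *\<^sub>R (f s - (f t + (s - t) *\<^sub>R D)))) \<longlongrightarrow> 0) (at t) \<longleftrightarrow>
     ((\<lambda>s. norm (inverse (s - t) *\<^sub>R (f s - f t) - D)) \<longlongrightarrow> 0) (at t)"
    by (intro Lim_cong_within) auto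
  then show ?thesis
    unfolding has_vector_derivative_def has_derivative_within tendsto_norm_zero_iff
    by (auto simp: LIM_zero_iff bounded_linear_scaleR_left)
qed

text \<open>The mean value inequality bounds every difference quotient by \<open>D x\<close>, so
  dominated convergence applies along any sequence tending to \<open>t\<close>. Measurability of
  \<open>f' t\<close> follows because it is the limit of these quotients.\<close>

lemma has_vector_derivative_integral_dominated:
  fixes f f' :: "real \<Rightarrow> 'a \<Rightarrow> 'b::{banach,second_countable_topology}"
  assumes e: "e > 0"
    and der: "\<And>x s. \<bar>s - t\<bar> < e \<Longrightarrow> ((\<lambda>s. f s x) has_vector_derivative f' s x) (at s)"
    and bd: "\<And>x s. \<bar>s - t\<bar> < e \<Longrightarrow> norm (f' s x) \<le> D x"
    and D: "integrable M D"
    and int: "\<And>s. \<bar>s - t\<bar> < e \<Longrightarrow> integrable M (f s)"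
  shows "((\<lambda>s. \<integral>x. f s x \<partial>M) has_vector_derivative (\<integral>x. f' t x \<partial>M)) (at t)"
  unfolding has_vector_derivative_iff_tendsto
proof (subst tendsto_at_iff_sequentially, intro allI impI)
  have quot: "((\<lambda>s. inverse (s - t) *\<^sub>R (f s x - f t x)) \<longlongrightarrow> f' t x) (at t)" for x
    using der[of t x] e by (simp add: has_vector_derivative_iff_tendsto)
  have lip: "norm (f s x - f t x) \<le> D x * \<bar>s - t\<bar>" if "\<bar>s - t\<bar> < e" for s x
  proof -
    have "norm (f s x - f t x) \<le> D x * norm (s - t)"
    proof (rule differentiable_bound)
      show "convex (ball t e)" by simp
      show "((\<lambda>s. f s x) has_derivative (\<lambda>h. h *\<^sub>R f' y x)) (at y within ball t e)" if "y \<in> ball t e" for y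
        using der[of y x] that unfolding has_vector_derivative_def
        by (auto simp: dist_real_def abs_minus_commute intro: has_derivative_at_withinI)
      show "onorm (\<lambda>h. h *\<^sub>R f' y x) \<le> D x" if "y \<in> ball t e" for y
        using mult_left_mono[OF bd[of y x] abs_ge_zero] that
        by (intro onorm_le) (auto simp: dist_real_def abs_minus_commute mult.commute)
    qed (use that e in \<open>auto simp: dist_real_def abs_minus_commute\<close>)
    then show ?thesis by simp
  qed
  fix X :: "nat \<Rightarrow> real"
  assume X: "\<forall>i. X i \<in> UNIV - {t}" and Xt: "X \<longlonglongrightarrow> t"
  \<comment> \<open>Only a tail of \<open>X\<close> is within \<open>e\<close> of \<open>t\<close>;
    the index is shifted by \<open>N\<close> here and shifted back at the end.\<close>
  obtain N where N: "\<And>n. n \<ge> N \<Longrightarrow> \<bar>X n - t\<bar> < e"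
    using Xt e unfolding lim_sequentially dist_real_def by metis
  let ?q = "\<lambda>n x. inverse (X (n + N) - t) *\<^sub>R (f (X (n + N)) x - f t x)"
  have lim: "(\<lambda>n. ?q n x) \<longlonglongrightarrow> f' t x" for x
  proof -
    have "((\<lambda>s. inverse (s - t) *\<^sub>R (f s x - f t x)) \<circ> X) \<longlonglongrightarrow> f' t x"
      using quot[of x] X Xt unfolding tendsto_at_iff_sequentially by blast
    from LIMSEQ_ignore_initial_segment[OF this, of N] show ?thesis by (simp add: o_def)
  qed
  have q_int: "integrable M (?q n)" for n
    using int[of t] int[OF N[of "n + N"]] e by (intro integrable_scaleR_right Bochner_Integration.integrable_diff) auto
  have meas: "f' t \<in> borel_measurable M"
    by (rule borel_measurable_LIMSEQ_metric[OF _ lim]) (use q_int in auto)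
  have "(\<lambda>n. integral\<^sup>L M (?q n)) \<longlonglongrightarrow> (\<integral>x. f' t x \<partial>M)"
  proof (rule integral_dominated_convergence[OF meas _ D])
    show "AE x in M. norm (?q n x) \<le> D x" for n
    proof (rule AE_I2)
      fix x
      let ?d = "X (n + N) - t"
      have d: "?d \<noteq> 0" using X by auto
      have "norm (?q n x) = inverse \<bar>?d\<bar> * norm (f (X (n + N)) x - f t x)" by simp
      also have "\<dots> \<le> inverse \<bar>?d\<bar> * (D x * \<bar>?d\<bar>)"
        by (intro mult_left_mono lip[OF N]) auto
      also have "\<dots> = D x" using d by simp
      finally show "norm (?q n x) \<le> D x" .
    qed
  qed (use q_int lim in auto)
  also have "(\<lambda>n. integral\<^sup>L M (?q n)) =
     (\<lambda>n. inverse (X (n + N) - t) *\<^sub>R ((\<integral>x. f (X (n + N)) x \<partial>M) - (\<integral>x. f t x \<partial>M)))"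
    using int[of t] int[OF N] e by (auto simp: Bochner_Integration.integral_diff)
  finally have "(\<lambda>n. inverse (X (n + N) - t) *\<^sub>R ((\<integral>x. f (X (n + N)) x \<partial>M) - (\<integral>x. f t x \<partial>M))) \<longlonglongrightarrow> (\<integral>x. f' t x \<partial>M)" .
  then show "((\<lambda>s. inverse (s - t) *\<^sub>R ((\<integral>x. f s x \<partial>M) - (\<integral>x. f t x \<partial>M))) \<circ> X) \<longlonglongrightarrow> (\<integral>x. f' t x \<partial>M)"
    unfolding o_def by (rule LIMSEQ_offset)
qed

text \<open>The hypothesis holds at every base point, so the derivative at \<open>s\<close> is the
  derivative at 0 with the base point moved to \<open>x + s *\<^sub>R e\<close>.\<close>

lemma has_vector_derivative_line_at:
  fixes f :: "'a::real_normed_vector \<Rightarrow> 'b::real_normed_vector"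
  assumes "\<And>x. ((\<lambda>h. f (x + h *\<^sub>R e)) has_vector_derivative f' x) (at 0)"
  shows "((\<lambda>h. f (x + h *\<^sub>R e)) has_vector_derivative f' (x + s *\<^sub>R e)) (at s)"
proof -
  have "((\<lambda>h. f ((x + s *\<^sub>R e) + h *\<^sub>R e)) has_vector_derivative f' (x + s *\<^sub>R e)) (at (s - s))"
    using assms[of "x + s *\<^sub>R e"] by simp
  then have "((\<lambda>h. f ((x + s *\<^sub>R e) + h *\<^sub>R e)) \<circ> (\<lambda>h. h - s) has_vector_derivative 1 *\<^sub>R f' (x + s *\<^sub>R e)) (at s)"
    by (intro vector_diff_chain_at) (auto intro!: derivative_eq_intros)
  moreover have "(x + s *\<^sub>R e) + (h - s) *\<^sub>R e = x + h *\<^sub>R e" for h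
    by (simp add: algebra_simps)
  ultimately show ?thesis by (simp add: o_def)
qed

text \<open>By translation invariance of \<open>lborel\<close> the integral of
  \<open>F p (x + h e)\<close> does not depend on \<open>h\<close>, and differentiating it at h = 0
  under the integral gives the claim. Every later integration by parts rests on this; decay replaces
  the boundary terms.\<close>

lemma integral_directional_derivative_eq_0:
  fixes F F' :: "'p \<Rightarrow> real^'n::finite \<Rightarrow> 'b::{banach,second_countable_topology}"
  assumes F: "decays F" and F': "decays F'"
    and meas: "F p \<in> borel_measurable borel"
    and der: "\<And>x. ((\<lambda>h. F p (x + h *\<^sub>R e)) has_vector_derivative F' p x) (at 0)"
  shows "(\<integral>x. F' p x \<partial>lborel) = 0"
proof -
  obtain K c where *: "K > 0" "c > 0" "\<And>p x. norm (F' p x) \<le> K * exp (- c * norm x)"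
    using F' unfolding decays_def by blast
  have shift: "(\<integral>x. F p (x + h *\<^sub>R e) \<partial>lborel) = (\<integral>x. F p x \<partial>lborel)"
     "integrable lborel (\<lambda>x. F p (x + h *\<^sub>R e))" for h
  proof -
    have d: "distr lborel borel (\<lambda>x. h *\<^sub>R e + x) = (lborel :: (real^'n) measure)"
      by (rule lborel_distr_plus)
    have "(\<integral>x. F p x \<partial>lborel) = (\<integral>x. F p x \<partial>distr lborel borel (\<lambda>x. h *\<^sub>R e + x))"
      by (simp add: d)
    also have "\<dots> = (\<integral>x. F p (h *\<^sub>R e + x) \<partial>lborel)"
      by (rule integral_distr) (use meas in auto)
    finally show "(\<integral>x. F p (x + h *\<^sub>R e) \<partial>lborel) = (\<integral>x. F p x \<partial>lborel)"
      by (simp add: add.commute)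
    have "integrable (distr lborel borel (\<lambda>x. h *\<^sub>R e + x)) (F p)"
      unfolding d using meas by (intro decays_integrable[OF F]) simp
    then have "integrable lborel (\<lambda>x. F p (h *\<^sub>R e + x))"
      by (rule integrable_distr[rotated]) simp
    then show "integrable lborel (\<lambda>x. F p (x + h *\<^sub>R e))"
      by (simp only: add.commute)
  qed
  have "((\<lambda>h. \<integral>x. F p (x + h *\<^sub>R e) \<partial>lborel) has_vector_derivative (\<integral>x. F' p (x + 0 *\<^sub>R e) \<partial>lborel)) (at 0)"
  proof (rule has_vector_derivative_integral_dominated[where e = 1 and f' = "\<lambda>h x. F' p (x + h *\<^sub>R e)"])
    show "((\<lambda>h. F p (x + h *\<^sub>R e)) has_vector_derivative F' p (x + s *\<^sub>R e)) (at s)" for x s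
      by (rule has_vector_derivative_line_at[OF der])
    \<comment> \<open>A shift by at most |e| changes the exponential by at most the factor
      \<open>exp (c * norm e)\<close>, which gives a bound uniform in \<open>s\<close>.\<close>
    show "norm (F' p (x + s *\<^sub>R e)) \<le> K * exp (c * norm e) * exp (- c * norm x)" if "\<bar>s - 0\<bar> < 1" for x s
    proof -
      have "norm x = norm ((x + s *\<^sub>R e) - s *\<^sub>R e)" by simp
      also have "\<dots> \<le> norm (x + s *\<^sub>R e) + \<bar>s\<bar> * norm e" by (metis norm_triangle_ineq4 norm_scaleR)
      also have "\<dots> \<le> norm (x + s *\<^sub>R e) + norm e" using that by (simp add: mult_left_le_one_le)
      finally have n: "norm x - norm e \<le> norm (x + s *\<^sub>R e)" by simp
      have "norm (F' p (x + s *\<^sub>R e)) \<le> K * exp (- c * norm (x + s *\<^sub>R e))" by (rule *)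
      also have "\<dots> \<le> K * exp (- c * (norm x - norm e))" using * n by (intro mult_left_mono) auto
      also have "\<dots> = K * exp (c * norm e) * exp (- c * norm x)" by (simp add: exp_add[symmetric] algebra_simps)
      finally show ?thesis .
    qed
    show "integrable lborel (\<lambda>x::real^'n. K * exp (c * norm e) * exp (- c * norm x))"
      using integrable_exp_neg_norm[OF *(2)] by (rule integrable_mult_right)
  qed (use shift in auto)
  then have "((\<lambda>h::real. \<integral>x. F p x \<partial>lborel) has_vector_derivative (\<integral>x. F' p x \<partial>lborel)) (at 0)"
    by (simp add: shift)
  then show ?thesis
    using vector_derivative_unique_at[OF _ has_vector_derivative_const] by blast
qed

section \<open>The logarithmic nonlinearity\<close>

text \<open>With r = sqrt |z| the left side is 4 r^2 |ln r|, and |ln r| <= r + 1/r. The square root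
  gives continuity at 0 and lets exponential decay pass to the nonlinearity.\<close>

lemma norm_log_nonlin_le: "cmod (log_nonlin z) \<le> 4 * sqrt (cmod z) * (1 + cmod z)"
proof (cases "z = 0")
  case False
  define r where "r = sqrt (cmod z)"
  have r: "r > 0" "cmod z = r\<^sup>2" using False by (auto simp: r_def)
  have "\<bar>ln r\<bar> \<le> r + 1 / r"
  proof -
    have "ln r \<le> r" using ln_le_minus_one[OF r(1)] by simp
    moreover have "ln (1 / r) \<le> 1 / r" using ln_le_minus_one[of "1 / r"] r(1) by simp
    moreover have "ln (1 / r) = - ln r" using r(1) by (simp add: ln_div)
    moreover have "0 < 1 / r" using r by simp
    ultimately show ?thesis using r(1) by linarith
  qed
  then have "r\<^sup>2 * \<bar>ln r\<bar> \<le> r\<^sup>2 * (r + 1 / r)" by (intro mult_left_mono) auto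
  also have "\<dots> = r * (1 + r\<^sup>2)" using r by (simp add: field_simps power2_eq_square)
  finally have "r\<^sup>2 * \<bar>ln r\<bar> \<le> r * (1 + r\<^sup>2)" .
  moreover have "cmod (log_nonlin z) = 4 * (r\<^sup>2 * \<bar>ln r\<bar>)"
    using False r by (simp add: log_nonlin_def norm_mult ln_realpow abs_mult)
  ultimately show ?thesis using r by (simp add: r_def[symmetric])
qed (simp add: log_nonlin_def)

lemma isCont_log_nonlin: "isCont log_nonlin z"
proof (cases "z = 0")
  case True
  have "((\<lambda>z. 4 * sqrt (cmod z) * (1 + cmod z)) \<longlongrightarrow> 4 * sqrt (cmod 0) * (1 + cmod 0)) (at 0)"
    by (intro tendsto_intros)
  then have lim: "((\<lambda>z. 4 * sqrt (cmod z) * (1 + cmod z)) \<longlongrightarrow> 0) (at 0)" by simp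
  have "(log_nonlin \<longlongrightarrow> 0) (at 0)"
    by (rule Lim_null_comparison[OF always_eventually lim]) (blast intro: norm_log_nonlin_le)
  then show ?thesis using True by (simp add: isCont_def log_nonlin_def)
next
  case False
  have "isCont (\<lambda>w. complex_of_real (ln ((cmod w)\<^sup>2)) * w) z"
    using False by (intro continuous_intros) auto
  moreover have "eventually (\<lambda>w. complex_of_real (ln ((cmod w)\<^sup>2)) * w = log_nonlin w) (nhds z)"
    using t1_space_nhds[OF False] by (rule eventually_mono) (auto simp: log_nonlin_def)
  ultimately show ?thesis using isCont_cong[of "\<lambda>w. complex_of_real (ln ((cmod w)\<^sup>2)) * w" log_nonlin z] by simp
qed

lemma continuous_on_log_nonlin: "continuous_on UNIV log_nonlin"
  by (simp add: continuous_at_imp_continuous_on isCont_log_nonlin)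

text \<open>This is |z|^2 ln |z|^2 - |z|^2, written through \<open>log_nonlin\<close> so that the
  value at 0 is covered and the difference to \<open>Re (log_nonlin z * cnj z)\<close> is visibly
  |z|^2.\<close>

definition log_potential :: "complex \<Rightarrow> real" where
  "log_potential z = Re (log_nonlin z * cnj z) - (cmod z)\<^sup>2"

text \<open>The nonlinearity is half the real gradient of the potential. Zeros of the function to
  which this is applied are unavoidable, so the point 0 must be included: there the quotient is at
  most |f(h)| + |h| with f the nonlinearity, which tends to 0.\<close>

lemma has_derivative_log_potential:
  "(log_potential has_derivative (\<lambda>h. 2 * Re (log_nonlin z * cnj h))) (at z)"
proof (cases "z = 0")
  case True
  have "((\<lambda>h. norm (log_potential h) / norm h) \<longlongrightarrow> 0) (at 0)"
  proof (rule Lim_null_comparison[OF always_eventually])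
    have "norm (log_potential h) \<le> (cmod (log_nonlin h) + cmod h) * cmod h" for h
    proof -
      have "\<bar>Re (log_nonlin h * cnj h)\<bar> \<le> cmod (log_nonlin h) * cmod h"
        using abs_Re_le_cmod[of "log_nonlin h * cnj h"] by (simp add: norm_mult)
      then have "\<bar>log_potential h\<bar> \<le> cmod (log_nonlin h) * cmod h + (cmod h)\<^sup>2"
        unfolding log_potential_def
        by (intro order_trans[OF abs_triangle_ineq4]) simp
      then show ?thesis by (simp add: algebra_simps power2_eq_square)
    qed
    then show "\<forall>h. norm (norm (log_potential h) / norm h) \<le> cmod (log_nonlin h) + cmod h"
      by (auto simp: divide_le_eq add_nonneg_nonneg)
    have "((\<lambda>h. cmod (log_nonlin h) + cmod h) \<longlongrightarrow> cmod (log_nonlin 0) + cmod 0) (at 0)"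
      using isCont_log_nonlin[of 0] by (intro tendsto_intros) (simp add: isCont_def)
    then show "((\<lambda>h. cmod (log_nonlin h) + cmod h) \<longlongrightarrow> 0) (at 0)"
      by (simp add: log_nonlin_def)
  qed
  then show ?thesis
    unfolding True has_derivative_iff_norm by (simp add: log_potential_def log_nonlin_def)
next
  case False
  have d: "((\<lambda>w. w \<bullet> w) has_derivative (\<lambda>h. 2 * (z \<bullet> h))) (at z)"
    by (auto intro!: derivative_eq_intros simp: inner_commute)
  have "((\<lambda>w. (w \<bullet> w) * ln (w \<bullet> w) - w \<bullet> w) has_derivative
      (\<lambda>h. 2 * (z \<bullet> h) * ln (z \<bullet> z))) (at z)"
    using False by (auto intro!: derivative_eq_intros d simp: algebra_simps inner_commute)
  moreover have "2 * (z \<bullet> h) * ln (z \<bullet> z) = 2 * Re (log_nonlin z * cnj h)" for h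
    using False by (simp add: log_nonlin_def power2_norm_eq_inner) (simp add: inner_complex_def algebra_simps)
  ultimately have "((\<lambda>w. (w \<bullet> w) * ln (w \<bullet> w) - w \<bullet> w) has_derivative
      (\<lambda>h. 2 * Re (log_nonlin z * cnj h))) (at z)"
    by simp
  \<comment> \<open>The equality includes w = 0, where the factor \<open>w \<bullet> w\<close>
    cancels whatever value \<open>ln 0\<close> has.\<close>
  moreover have "(\<lambda>w. (w \<bullet> w) * ln (w \<bullet> w) - w \<bullet> w) = log_potential"
    by (auto simp: fun_eq_iff log_potential_def log_nonlin_def power2_norm_eq_inner inner_complex_def algebra_simps)
  ultimately show ?thesis by simp
qed

lemma has_vector_derivative_log_potential:
  assumes "(c has_vector_derivative c') (at t)"
  shows "((\<lambda>s. log_potential (c s)) has_vector_derivative 2 * Re (log_nonlin (c t) * cnj c')) (at t)"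
proof -
  have "(log_potential \<circ> c has_derivative (\<lambda>h. 2 * Re (log_nonlin z * cnj h)) \<circ> (\<lambda>h. h *\<^sub>R c')) (at t)" if "z = c t" for z
    using assms has_derivative_log_potential[of "c t"] that unfolding has_vector_derivative_def
    by (intro diff_chain_at) auto
  then show ?thesis unfolding has_vector_derivative_def by (simp add: o_def algebra_simps)
qed

text \<open>The square root in the growth bound halves the rate; the remaining factor is
  bounded.\<close>

lemma decays_log_nonlin:
  fixes F :: "'p \<Rightarrow> 'a::real_normed_vector \<Rightarrow> complex"
  assumes "decays F"
  shows "decays (\<lambda>p x. log_nonlin (F p x))"
proof -
  obtain K c where *: "K > 0" "c > 0" "\<And>p x. norm (F p x) \<le> K * exp (- c * norm x)"
    using assms unfolding decays_def by blast
  obtain L where L: "L > 0" "\<And>p x. norm (F p x) \<le> L" using decays_bounded[OF assms] by metis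
  show ?thesis
  proof (rule decaysI[where c = "c / 2" and K = "4 * sqrt K * (1 + L)"])
    fix p and x :: 'a
    have "sqrt (exp (- c * norm x)) = exp (- (c / 2) * norm x)"
    proof (rule real_sqrt_unique)
      show "(exp (- (c / 2) * norm x))\<^sup>2 = exp (- c * norm x)"
        by (simp add: exp_double[symmetric])
    qed simp
    moreover have "sqrt (cmod (F p x)) \<le> sqrt (K * exp (- c * norm x))"
      by (rule real_sqrt_le_mono[OF *(3)])
    ultimately have s: "sqrt (cmod (F p x)) \<le> sqrt K * exp (- (c / 2) * norm x)"
      by (simp add: real_sqrt_mult)
    have "cmod (log_nonlin (F p x)) \<le> 4 * sqrt (cmod (F p x)) * (1 + cmod (F p x))"
      by (rule norm_log_nonlin_le)
    also have "\<dots> \<le> 4 * (sqrt K * exp (- (c / 2) * norm x)) * (1 + L)"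
      using s L * by (intro mult_mono) auto
    also have "\<dots> = 4 * sqrt K * (1 + L) * exp (- (c / 2) * norm x)" by (simp only: mult_ac)
    finally show "cmod (log_nonlin (F p x)) \<le> 4 * sqrt K * (1 + L) * exp (- (c / 2) * norm x)" .
  qed (use * in auto)
qed

section \<open>Mollifiers\<close>

text \<open>If the integral were 0, the closed zero set of \<open>f\<close> would have full measure,
  hence be the whole space.\<close>

lemma integral_pos_continuous:
  fixes f :: "'a::euclidean_space \<Rightarrow> real"
  assumes "continuous_on UNIV f" "\<And>x. f x \<ge> 0" "integrable lborel f" "f x0 > 0"
  shows "(\<integral>x. f x \<partial>lborel) > 0"
proof (rule ccontr)
  assume "\<not> (\<integral>x. f x \<partial>lborel) > 0"
  moreover have "(\<integral>x. f x \<partial>lborel) \<ge> 0" using assms by simp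
  ultimately have "(\<integral>x. f x \<partial>lborel) = 0" by simp
  then have "AE x in lborel. f x = 0"
    using integral_nonneg_eq_0_iff_AE[OF assms(3)] assms(2) by simp
  then have "AE x in lebesgue. x \<in> {x. f x = 0}"
    by (simp add: AE_completion)
  moreover have "closed {x. f x = 0}"
    using assms(1) by (intro closed_Collect_eq continuous_intros) auto
  ultimately have "x0 \<in> {x. f x = 0}" by (rule mem_closed_if_AE_lebesgue[rotated])
  then show False using assms(4) by simp
qed

text \<open>For \<open>p = 1\<close> this is the classical smooth function exp (-1/x) extended by 0.
  The polynomial factor in 1/x makes the family closed under differentiation.\<close>

definition flat :: "real poly \<Rightarrow> real \<Rightarrow> real" where
  "flat p x = (if x > 0 then poly p (inverse x) * exp (- inverse x) else 0)"

lemma poly_mult_exp_neg_tendsto_0: "((\<lambda>y::real. poly p y * exp (- y)) \<longlongrightarrow> 0) at_top"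
proof -
  have "((\<lambda>y::real. \<Sum>i\<le>degree p. coeff p i * (y ^ i / exp y)) \<longlongrightarrow> (\<Sum>i\<le>degree p. coeff p i * 0)) at_top"
    by (intro tendsto_sum tendsto_mult tendsto_const tendsto_power_div_exp_0)
  then show ?thesis
    by (simp add: poly_altdef sum_distrib_right exp_minus divide_inverse mult.assoc)
qed

text \<open>With y = 1/x, the derivative of p(y) exp (-y) is y^2 (p - p')(y) exp (-y), and
  \<open>[:0, 0, 1:]\<close> is y^2. At 0 the two one-sided difference quotients tend to 0.\<close>

lemma flat_has_derivative:
  "(flat p has_real_derivative flat ([:0, 0, 1:] * (p - pderiv p)) x) (at x)"
proof -
  consider "x > 0" | "x < 0" | "x = 0" by linarith
  then show ?thesis
  proof cases
    case 1
    have "((\<lambda>x. poly p (inverse x) * exp (- inverse x)) has_real_derivative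
       flat ([:0, 0, 1:] * (p - pderiv p)) x) (at x)"
      using 1 by (auto intro!: derivative_eq_intros poly_DERIV simp: flat_def)
        (simp add: field_simps power2_eq_square)
    then show ?thesis
      by (rule has_field_derivative_transform_within_open[where S = "{0<..}"]) (use 1 in \<open>auto simp: flat_def\<close>)
  next
    case 2
    have "((\<lambda>x. 0) has_real_derivative 0) (at x)" by simp
    then have "(flat p has_real_derivative 0) (at x)"
      by (rule has_field_derivative_transform_within_open[where S = "{..<0}"]) (use 2 in \<open>auto simp: flat_def\<close>)
    then show ?thesis using 2 by (simp add: flat_def)
  next
    case 3
    \<comment> \<open>The factor \<open>[:0, 1:]\<close> is the division by h in the difference
      quotient, so the quotient is again of the flat form.\<close>
    have "((\<lambda>y. poly ([:0, 1:] * p) (inverse y) * exp (- inverse y)) \<longlongrightarrow> 0) (at_right 0)"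
      by (rule filterlim_compose[OF poly_mult_exp_neg_tendsto_0 filterlim_inverse_at_top_right])
    then have R: "((\<lambda>h. flat p h / h) \<longlongrightarrow> 0) (at_right 0)"
      by (rule Lim_transform_eventually)
        (auto simp: eventually_at_right_less flat_def divide_inverse intro!: eventually_mono[OF eventually_at_right_less])
    have L: "((\<lambda>h. flat p h / h) \<longlongrightarrow> 0) (at_left 0)"
      by (rule Lim_transform_eventually[OF tendsto_const])
        (auto simp: flat_def eventually_at_filter)
    have "((\<lambda>h. flat p h / h) \<longlongrightarrow> 0) (at 0)"
      using L R by (rule filterlim_split_at)
    then show ?thesis using 3 by (simp add: DERIV_def flat_def)
  qed
qed

text \<open>A class of functions supported in [-d, d] that is closed under differentiation by the
  product rule; membership therefore yields derivatives of all orders.\<close>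

inductive bumpy :: "real \<Rightarrow> (real \<Rightarrow> real) \<Rightarrow> bool" for d where
  base: "bumpy d (\<lambda>x. flat p (d + x) * flat q (d - x))"
| add: "bumpy d f \<Longrightarrow> bumpy d g \<Longrightarrow> bumpy d (\<lambda>x. f x + g x)"
| minus: "bumpy d f \<Longrightarrow> bumpy d (\<lambda>x. - f x)"

lemma bumpy_derivative:
  assumes "bumpy d f"
  obtains f' where "bumpy d f'" "\<And>x. (f has_real_derivative f' x) (at x)"
proof -
  have "\<exists>f'. bumpy d f' \<and> (\<forall>x. (f has_real_derivative f' x) (at x))"
    using assms
  proof induction
    case (base p q)
    let ?D = "\<lambda>p. [:0, 0, 1:] * (p - pderiv p) :: real poly"
    let ?f' = "\<lambda>x. flat (?D p) (d + x) * flat q (d - x) + - (flat p (d + x) * flat (?D q) (d - x))"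
    have "((\<lambda>x. flat p (d + x) * flat q (d - x)) has_real_derivative ?f' x) (at x)" for x
    proof -
      have "((\<lambda>x. flat p (d + x)) has_real_derivative flat (?D p) (d + x) * 1) (at x)"
        by (rule DERIV_chain2[OF flat_has_derivative]) (auto intro!: derivative_eq_intros)
      moreover have "((\<lambda>x. flat q (d - x)) has_real_derivative flat (?D q) (d - x) * (-1)) (at x)"
        by (rule DERIV_chain2[OF flat_has_derivative]) (auto intro!: derivative_eq_intros)
      ultimately show ?thesis
        by (rule DERIV_cong[OF DERIV_mult]) simp
    qed
    moreover have "bumpy d ?f'" by (intro bumpy.intros)
    ultimately show ?case by blast
  next
    case (add f g)
    then obtain f' g' where "bumpy d f'" "\<forall>x. (f has_real_derivative f' x) (at x)"
      "bumpy d g'" "\<forall>x. (g has_real_derivative g' x) (at x)" by blast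
    then show ?case by (intro exI[of _ "\<lambda>x. f' x + g' x"]) (auto intro: bumpy.add DERIV_add)
  next
    case (minus f)
    then obtain f' where "bumpy d f'" "\<forall>x. (f has_real_derivative f' x) (at x)" by blast
    then show ?case by (intro exI[of _ "\<lambda>x. - f' x"]) (auto intro: bumpy.minus DERIV_minus)
  qed
  then show ?thesis using that by blast
qed

lemma bumpy_deriv:
  assumes "bumpy d f"
  shows "bumpy d (deriv f)" "(f has_real_derivative deriv f x) (at x)"
proof -
  obtain f' where f': "bumpy d f'" "\<And>x. (f has_real_derivative f' x) (at x)"
    using bumpy_derivative[OF assms] by blast
  then have "deriv f = f'" by (auto intro: DERIV_imp_deriv)
  with f' show "bumpy d (deriv f)" "(f has_real_derivative deriv f x) (at x)" by auto
qed

lemma bumpy_deriv_funpow: "bumpy d f \<Longrightarrow> bumpy d ((deriv ^^ k) f)"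
  by (induction k) (auto intro: bumpy_deriv)

text \<open>A partial derivative acts on a single factor of a product of one-variable functions. The
  result depends only on how often each direction occurs, which makes the order of differentiation
  irrelevant.\<close>

lemma iter_partial_prod:
  fixes b :: "real \<Rightarrow> real" and c :: real
  assumes b: "bumpy d b"
  shows "iter_partial is (\<lambda>x::real^'n::finite. complex_of_real (c * (\<Prod>i\<in>UNIV. b (x $ i)))) =
    (\<lambda>x. complex_of_real (c * (\<Prod>i\<in>UNIV. (deriv ^^ count_list is i) b (x $ i))))"
proof (induction "is")
  case (Cons j "is")
  let ?B = "\<lambda>i. (deriv ^^ count_list is i) b"
  have "partial_deriv j (\<lambda>x::real^'n. complex_of_real (c * (\<Prod>i\<in>UNIV. ?B i (x $ i)))) x =
     complex_of_real (c * (\<Prod>i\<in>UNIV. (deriv ^^ count_list (j # is) i) b (x $ i)))" for x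
  proof -
    have split: "(\<Prod>i\<in>UNIV. g i) = g j * (\<Prod>i\<in>UNIV - {j}. g i)" for g :: "'n \<Rightarrow> real"
      by (rule prod.remove) auto
    have "((\<lambda>h. ?B j (x $ j + h)) has_real_derivative deriv (?B j) (x $ j + 0) * 1) (at 0)"
      by (rule DERIV_chain2[OF bumpy_deriv(2)[OF bumpy_deriv_funpow[OF b]]]) (auto intro!: derivative_eq_intros)
    then have "((\<lambda>h. c * (?B j (x $ j + h) * (\<Prod>i\<in>UNIV - {j}. ?B i (x $ i)))) has_real_derivative
        c * (deriv (?B j) (x $ j) * (\<Prod>i\<in>UNIV - {j}. ?B i (x $ i)))) (at 0)"
      by (auto intro!: DERIV_cmult DERIV_cmult_right)
    moreover have "c * (?B j (x $ j + h) * (\<Prod>i\<in>UNIV - {j}. ?B i (x $ i))) =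
       c * (\<Prod>i\<in>UNIV. ?B i ((x + h *\<^sub>R axis j 1) $ i))" for h
      unfolding split by (auto simp: axis_def intro!: prod.cong)
    moreover have "deriv (?B j) (x $ j) * (\<Prod>i\<in>UNIV - {j}. ?B i (x $ i)) =
       (\<Prod>i\<in>UNIV. (deriv ^^ count_list (j # is) i) b (x $ i))"
      unfolding split by (auto intro!: prod.cong)
    ultimately have "((\<lambda>h. c * (\<Prod>i\<in>UNIV. ?B i ((x + h *\<^sub>R axis j 1) $ i))) has_real_derivative
       c * (\<Prod>i\<in>UNIV. (deriv ^^ count_list (j # is) i) b (x $ i))) (at 0)"
      by simp
    then have "((\<lambda>h. complex_of_real (c * (\<Prod>i\<in>UNIV. ?B i ((x + h *\<^sub>R axis j 1) $ i)))) has_vector_derivative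
       complex_of_real (c * (\<Prod>i\<in>UNIV. (deriv ^^ count_list (j # is) i) b (x $ i)))) (at 0)"
      by (intro has_vector_derivative_of_real) (simp add: has_real_derivative_iff_has_vector_derivative)
    then show ?thesis
      unfolding partial_deriv_def by (rule vector_derivative_at)
  qed
  then show ?case unfolding iter_partial.simps Cons.IH by (rule ext)
qed simp

lemma smooth_prod:
  assumes "bumpy d b"
  shows "smooth (\<lambda>x::real^'n::finite. complex_of_real (c * (\<Prod>i\<in>UNIV. b (x $ i))))"
  unfolding smooth_def iter_partial_prod[OF assms]
proof (intro allI)
  fix js :: "'n list" and x :: "real^'n"
  let ?B = "\<lambda>i. (deriv ^^ count_list js i) b"
  have "((\<lambda>x. ?B i (x $ i)) has_derivative (\<lambda>h. (h $ i) * deriv (?B i) (x $ i))) (at x)" for i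
    using diff_chain_at[OF bounded_linear.has_derivative[OF bounded_linear_vec_nth has_derivative_ident]
        bumpy_deriv(2)[OF bumpy_deriv_funpow[OF assms], unfolded has_field_derivative_def]]
    by (simp add: o_def mult.commute)
  then have "((\<lambda>x. \<Prod>i\<in>UNIV. ?B i (x $ i)) has_derivative
       (\<lambda>y. \<Sum>i\<in>UNIV. (y $ i) * deriv (?B i) (x $ i) * (\<Prod>j\<in>UNIV - {i}. ?B j (x $ j)))) (at x)"
    by (rule has_derivative_prod)
  then have "(\<lambda>x. \<Prod>i\<in>UNIV. ?B i (x $ i)) differentiable (at x)"
    by (rule differentiableI)
  then have "(\<lambda>x. c * (\<Prod>i\<in>UNIV. ?B i (x $ i))) differentiable (at x)"
    by (intro differentiable_mult) auto
  then obtain D where "((\<lambda>x. c * (\<Prod>i\<in>UNIV. ?B i (x $ i))) has_derivative D) (at x)"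
    unfolding differentiable_def by blast
  from bounded_linear.has_derivative[OF bounded_linear_of_real this]
  show "(\<lambda>x. complex_of_real (c * (\<Prod>i\<in>UNIV. ?B i (x $ i)))) differentiable (at x)"
    by (rule differentiableI)
qed

text \<open>The symmetry of mixed partial derivatives is immediate for the product functions constructed
  below; recording it here avoids an appeal to Schwarz's theorem.\<close>

definition mollifier :: "real \<Rightarrow> (real^'n::finite \<Rightarrow> complex) \<Rightarrow> bool" where
  "mollifier d \<phi> \<longleftrightarrow> test_fun \<phi> \<and> (\<forall>x. norm x > d \<longrightarrow> \<phi> x = 0) \<and>
     (\<forall>x. \<phi> x = complex_of_real (cmod (\<phi> x))) \<and> (\<integral>x. cmod (\<phi> x) \<partial>lborel) = 1 \<and>
     (\<forall>is i j. iter_partial (i # j # is) \<phi> = iter_partial (j # i # is) \<phi>)"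

text \<open>A product of one-variable bumps, divided by its mass. The mass is positive because the
  product is continuous, nonnegative and positive at the origin.\<close>

lemma exists_mollifier:
  assumes "d > 0"
  shows "\<exists>\<phi> :: real^'n::finite \<Rightarrow> complex. mollifier d \<phi>"
proof -
  \<comment> \<open>If |x| > d, the l1 norm exceeds d too, so some coordinate exceeds d/n in modulus
    and its factor vanishes.\<close>
  define \<delta> where "\<delta> = d / CARD('n)"
  have \<delta>: "\<delta> > 0" using assms by (simp add: \<delta>_def)
  define b where "b = (\<lambda>x. flat 1 (\<delta> + x) * flat 1 (\<delta> - x))"
  have b: "bumpy \<delta> b" unfolding b_def by (rule bumpy.base)
  have b_nonneg: "b x \<ge> 0" for x by (simp add: b_def flat_def)
  have b_0: "b 0 > 0" using \<delta> by (simp add: b_def flat_def)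
  have b_supp: "b x = 0" if "\<bar>x\<bar> > \<delta>" for x using that by (auto simp: b_def flat_def)
  let ?P = "\<lambda>c x::real^'n. complex_of_real (c * (\<Prod>i\<in>UNIV. b (x $ i)))"
  have supp: "?P c x = 0" if "norm x > d" for x c
  proof -
    have "\<exists>i. \<bar>x $ i\<bar> > \<delta>"
    proof (rule ccontr)
      assume "\<nexists>i. \<bar>x $ i\<bar> > \<delta>"
      then have "(\<Sum>i\<in>UNIV. \<bar>x $ i\<bar>) \<le> (\<Sum>i\<in>(UNIV::'n set). \<delta>)"
        by (intro sum_mono) (auto simp: not_less)
      also have "\<dots> = d" by (simp add: \<delta>_def)
      finally show False using norm_le_l1_cart[of x] that by simp
    qed
    then obtain i where "b (x $ i) = 0" using b_supp by blast
    then have "(\<Prod>i\<in>UNIV. b (x $ i)) = 0" by (intro prod_zero) auto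
    then show ?thesis by simp
  qed
  have test: "test_fun (?P c)" for c
    unfolding test_fun_def using smooth_prod[OF b] supp[of _ c]
    by (intro conjI exI[of _ "cball 0 d"]) auto
  define m where "m = (\<integral>x. cmod (?P 1 x) \<partial>lborel)"
  have m: "m > 0"
    unfolding m_def
  proof (rule integral_pos_continuous[of _ 0])
    show "continuous_on UNIV (\<lambda>x. cmod (?P 1 x))"
      using test_fun_continuous[OF test] by (rule continuous_on_norm)
    have "set_integrable lborel (cball 0 d) (?P 1)"
      using continuous_imp_locally_integrable[OF test_fun_continuous[OF test]] compact_cball
      unfolding locally_integrable_def by blast
    moreover have "indicator (cball 0 d) x *\<^sub>R ?P 1 x = ?P 1 x" for x
      using supp[of x 1] by (auto simp: indicator_def)
    ultimately have "integrable lborel (?P 1)" by (simp add: set_integrable_def)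
    then show "integrable lborel (\<lambda>x. cmod (?P 1 x))" by (rule integrable_norm)
    show "0 < cmod (?P 1 0)" using b_0 by (simp add: prod_pos)
  qed auto
  have nonneg: "(\<Prod>i\<in>UNIV. b (x $ i)) \<ge> 0" for x :: "real^'n" by (intro prod_nonneg) (auto simp: b_nonneg)
  have "mollifier d (?P (1 / m))"
    unfolding mollifier_def
  proof (intro conjI allI impI)
    show "test_fun (?P (1 / m))" by (rule test)
    show "?P (1 / m) x = 0" if "d < norm x" for x by (rule supp[OF that])
    show "?P (1 / m) x = complex_of_real (cmod (?P (1 / m) x))" for x
      using nonneg[of x] m by (simp only: norm_of_real) simp
    have "cmod (?P (1 / m) x) = (1 / m) * cmod (?P 1 x)" for x
      using m by (simp add: norm_mult norm_divide)
    then have "(\<integral>x. cmod (?P (1 / m) x) \<partial>lborel) = (1 / m) * m"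
      unfolding m_def by simp
    then show "(\<integral>x. cmod (?P (1 / m) x) \<partial>lborel) = 1" using m by simp
    show "iter_partial (i # j # is) (?P (1 / m)) = iter_partial (j # i # is) (?P (1 / m))" for "is" i j
      unfolding iter_partial_prod[OF b] by (auto intro!: arg_cong[where f = "\<lambda>n. (deriv ^^ n) b _"] prod.cong simp: fun_eq_iff)
  qed
  then show ?thesis by blast
qed

section \<open>Convolution with test functions\<close>

lemma iter_partial_snoc: "iter_partial is (partial_deriv i f) = iter_partial (is @ [i]) f"
  by (induction "is") auto

lemma smooth_partial_deriv: "smooth f \<Longrightarrow> smooth (partial_deriv i f)"
  unfolding smooth_def iter_partial_snoc by blast

lemma smooth_differentiable: "smooth f \<Longrightarrow> f differentiable (at x)"
  unfolding smooth_def using iter_partial.simps(1) by metis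

lemma smooth_continuous: "smooth f \<Longrightarrow> continuous_on UNIV f"
  using smooth_differentiable differentiable_imp_continuous_within continuous_at_imp_continuous_on by blast

lemma smooth_has_partial_deriv:
  assumes "smooth f"
  shows "((\<lambda>h. f (x + h *\<^sub>R axis i 1)) has_vector_derivative partial_deriv i f x) (at 0)"
proof -
  have "f differentiable at (x + 0 *\<^sub>R axis i 1)" using smooth_differentiable[OF assms] by simp
  moreover have "(\<lambda>h::real. x + h *\<^sub>R axis i 1) differentiable at 0" by (intro derivative_intros)
  ultimately have "(f \<circ> (\<lambda>h. x + h *\<^sub>R axis i 1)) differentiable at 0"
    by (intro differentiable_chain_at)
  then show ?thesis
    unfolding partial_deriv_def vector_derivative_works by (simp add: o_def)
qed

lemma partial_deriv_eq_0_outside: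
  assumes "\<And>x. norm x > R \<Longrightarrow> f x = 0" "norm x > R"
  shows "partial_deriv i f x = 0"
proof -
  have "open {h::real. norm (x + h *\<^sub>R axis i 1) > R}"
    by (intro open_Collect_less continuous_intros)
  then have "((\<lambda>h. f (x + h *\<^sub>R axis i 1)) has_vector_derivative 0) (at 0)"
    by (intro has_vector_derivative_transform_within_open[OF has_vector_derivative_const])
      (use assms in auto)
  then show ?thesis unfolding partial_deriv_def by (rule vector_derivative_at)
qed

lemma test_fun_support:
  assumes "test_fun \<phi>"
  obtains R where "R > 0" "\<And>x. norm x > R \<Longrightarrow> \<phi> x = 0"
proof -
  obtain K where K: "compact K" "\<And>x. x \<notin> K \<Longrightarrow> \<phi> x = 0"
    using assms by (auto simp: test_fun_def)
  obtain R where "R > 0" "\<And>x. x \<in> K \<Longrightarrow> norm x \<le> R"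
    using compact_imp_bounded[OF K(1)] bounded_pos by metis
  then show ?thesis using K(2) that by (meson not_less)
qed

lemma test_funI:
  assumes "smooth \<phi>" "\<And>x. norm x > R \<Longrightarrow> \<phi> x = 0"
  shows "test_fun \<phi>"
  unfolding test_fun_def using assms by (intro conjI exI[of _ "cball 0 R"]) auto

lemma test_fun_partial_deriv:
  assumes "test_fun \<phi>" shows "test_fun (partial_deriv i \<phi>)"
proof -
  obtain R where R: "\<And>x. norm x > R \<Longrightarrow> \<phi> x = 0" using test_fun_support[OF assms] by blast
  show ?thesis
  proof (rule test_funI[of _ R])
    show "smooth (partial_deriv i \<phi>)" using assms by (simp add: test_fun_def smooth_partial_deriv)
    show "partial_deriv i \<phi> x = 0" if "norm x > R" for x
      using R that by (rule partial_deriv_eq_0_outside)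
  qed
qed

lemma partial_deriv_reflect:
  assumes "smooth f"
  shows "partial_deriv i (\<lambda>y. c * f (x - y)) y = - c * partial_deriv i f (x - y)"
proof -
  have "((\<lambda>h. f (x - y + h *\<^sub>R axis i 1)) \<circ> uminus has_vector_derivative (-1) *\<^sub>R partial_deriv i f (x - y)) (at 0)"
    using smooth_has_partial_deriv[OF assms, of "x - y" i]
    by (intro vector_diff_chain_at) (auto intro!: derivative_eq_intros)
  then have "((\<lambda>h. f (x - (y + h *\<^sub>R axis i 1))) has_vector_derivative - partial_deriv i f (x - y)) (at 0)"
    by (simp add: o_def algebra_simps)
  from has_vector_derivative_mult_right[OF this, of c]
  show ?thesis unfolding partial_deriv_def[of i "\<lambda>y. c * f (x - y)"] by (intro vector_derivative_at) simp
qed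

lemma iter_partial_reflect:
  assumes "smooth f"
  shows "iter_partial is (\<lambda>y. f (x - y)) = (\<lambda>y. (-1) ^ length is * iter_partial is f (x - y))"
proof (induction "is")
  case (Cons i "is")
  have "smooth (iter_partial is f)"
    using assms by (induction "is") (auto intro: smooth_partial_deriv)
  from partial_deriv_reflect[OF this]
  show ?case by (simp add: Cons fun_eq_iff)
qed simp

text \<open>A convolution at the point \<open>x\<close> is a pairing with this function, so the weak
  time derivative may be tested against it.\<close>

lemma test_fun_reflect:
  fixes \<phi> :: "real^'n::finite \<Rightarrow> complex"
  assumes "test_fun \<phi>" shows "test_fun (\<lambda>y. \<phi> (x - y))"
proof -
  obtain R where R: "\<And>x. norm x > R \<Longrightarrow> \<phi> x = 0" using test_fun_support[OF assms] by blast
  have sm: "smooth \<phi>" using assms by (simp add: test_fun_def)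
  show ?thesis
  proof (rule test_funI[of _ "R + norm x"])
    show "smooth (\<lambda>y. \<phi> (x - y))"
      unfolding smooth_def iter_partial_reflect[OF sm]
    proof (intro allI)
      fix js and y :: "real^'n"
      have "iter_partial js \<phi> differentiable at (x - y)" using sm by (simp add: smooth_def)
      moreover have "(\<lambda>y. x - y) differentiable at y" by (intro derivative_intros)
      ultimately have "(iter_partial js \<phi> \<circ> (\<lambda>y. x - y)) differentiable at y"
        by (intro differentiable_chain_at)
      then show "(\<lambda>y. (- 1) ^ length js * iter_partial js \<phi> (x - y)) differentiable at y"
        by (intro derivative_intros) (simp add: o_def)
    qed
    fix y :: "real^'n" assume "norm y > R + norm x"
    then have "norm (x - y) > R" using norm_triangle_ineq2[of y x] by (simp add: norm_minus_commute)
    then show "\<phi> (x - y) = 0" by (rule R)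
  qed
qed

lemma decays_compact_support:
  fixes f :: "'a::euclidean_space \<Rightarrow> 'b::real_normed_vector"
  assumes "continuous_on UNIV f" "\<And>x. norm x > R \<Longrightarrow> f x = 0"
  shows "decays (\<lambda>_. f)"
proof -
  have "compact (f ` cball 0 R)"
    using assms(1) by (intro compact_continuous_image) (auto intro: continuous_on_subset)
  then obtain B where B: "B > 0" "\<And>x. x \<in> cball 0 R \<Longrightarrow> norm (f x) \<le> B"
    using compact_imp_bounded bounded_pos by (metis imageI)
  show ?thesis
  \<comment> \<open>The factor \<open>exp R\<close> compensates for the exponential on the ball of
    radius \<open>R\<close>.\<close>
  proof (rule decaysI[where c = 1 and K = "B * exp R"])
    fix x :: 'a
    show "norm (f x) \<le> B * exp R * exp (- 1 * norm x)"
    proof (cases "norm x \<le> R")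
      case True
      then have "norm (f x) \<le> B * 1" using B by simp
      also have "\<dots> \<le> B * (exp R * exp (- 1 * norm x))"
        using True B by (intro mult_left_mono) (auto simp: exp_add[symmetric])
      finally show ?thesis by simp
    qed (use assms(2)[of x] B in auto)
  qed simp
qed

lemma test_fun_decays: "test_fun \<phi> \<Longrightarrow> decays (\<lambda>_. \<phi>)"
  by (metis decays_compact_support test_fun_continuous test_fun_support)

lemma borel_measurable_test_fun: "test_fun \<phi> \<Longrightarrow> \<phi> \<in> borel_measurable borel"
  by (intro borel_measurable_continuous_onI test_fun_continuous)

text \<open>The product has compact support, so it decays, and the integral of its partial
  derivative is 0.\<close>

lemma integral_mult_partial_deriv:
  fixes f \<psi> :: "real^'n::finite \<Rightarrow> complex"
  assumes f: "smooth f" and \<psi>: "test_fun \<psi>"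
  shows "(\<integral>x. partial_deriv i f x * \<psi> x \<partial>lborel) = - (\<integral>x. f x * partial_deriv i \<psi> x \<partial>lborel)"
    and "integrable lborel (\<lambda>x. f x * \<psi> x)"
proof -
  have int: "integrable lborel (\<lambda>x. g x * \<eta> x)" "decays (\<lambda>_::unit. \<lambda>x. g x * \<eta> x)"
    if g: "continuous_on UNIV g" and \<eta>: "test_fun \<eta>" for g \<eta> :: "real^'n \<Rightarrow> complex"
  proof -
    obtain R where R: "\<And>x. norm x > R \<Longrightarrow> \<eta> x = 0" using test_fun_support[OF \<eta>] by blast
    have c: "continuous_on UNIV (\<lambda>x. g x * \<eta> x)"
      by (intro continuous_on_mult g \<eta> test_fun_continuous)
    show d: "decays (\<lambda>_::unit. \<lambda>x. g x * \<eta> x)"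
      by (rule decays_compact_support[OF c, of R]) (simp add: R)
    show "integrable lborel (\<lambda>x. g x * \<eta> x)"
      using decays_integrable[OF d] borel_measurable_continuous_onI[OF c] by simp
  qed
  have sm: "smooth \<psi>" using \<psi> by (simp add: test_fun_def)
  note f' = smooth_partial_deriv[OF f, of i]
  note \<psi>' = test_fun_partial_deriv[OF \<psi>, of i]
  note I = int(1)[OF smooth_continuous[OF f] \<psi>'] int(1)[OF smooth_continuous[OF f'] \<psi>]
  note D = int(2)[OF smooth_continuous[OF f] \<psi>'] int(2)[OF smooth_continuous[OF f'] \<psi>]
  have "(\<integral>x. (\<lambda>_::unit. \<lambda>x. f x * partial_deriv i \<psi> x + partial_deriv i f x * \<psi> x) () x \<partial>lborel) = 0"
  proof (rule integral_directional_derivative_eq_0[OF int(2)[OF smooth_continuous[OF f] \<psi>] decays_add[OF D]])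
    show "(\<lambda>x. f x * \<psi> x) \<in> borel_measurable borel"
      by (intro borel_measurable_continuous_onI continuous_on_mult smooth_continuous f sm)
    show "((\<lambda>h. f (x + h *\<^sub>R axis i 1) * \<psi> (x + h *\<^sub>R axis i 1)) has_vector_derivative
         f x * partial_deriv i \<psi> x + partial_deriv i f x * \<psi> x) (at 0)" for x
      using has_vector_derivative_mult[OF smooth_has_partial_deriv[OF f, of x i] smooth_has_partial_deriv[OF sm, of x i]]
      by simp
  qed
  then show "(\<integral>x. partial_deriv i f x * \<psi> x \<partial>lborel) = - (\<integral>x. f x * partial_deriv i \<psi> x \<partial>lborel)"
    using I by (simp add: add_eq_0_iff)
  show "integrable lborel (\<lambda>x. f x * \<psi> x)"
    by (rule int(1)[OF smooth_continuous[OF f] \<psi>])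
qed

lemma integral_laplacian_mult:
  fixes f \<psi> :: "real^'n::finite \<Rightarrow> complex"
  assumes f: "smooth f" and \<psi>: "test_fun \<psi>"
  shows "(\<integral>x. laplacian f x * \<psi> x \<partial>lborel) = (\<integral>x. f x * laplacian \<psi> x \<partial>lborel)"
    and "integrable lborel (\<lambda>x. laplacian f x * \<psi> x)"
proof -
  have eq: "laplacian f x * \<psi> x = (\<Sum>i\<in>UNIV. partial_deriv i (partial_deriv i f) x * \<psi> x)" for x
    by (simp add: laplacian_def sum_distrib_right)
  have I1: "integrable lborel (\<lambda>x. partial_deriv i (partial_deriv i f) x * \<psi> x)" for i
    by (intro integral_mult_partial_deriv(2) smooth_partial_deriv f \<psi>)
  have I2: "integrable lborel (\<lambda>x. f x * partial_deriv i (partial_deriv i \<psi>) x)" for i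
    by (intro integral_mult_partial_deriv(2) test_fun_partial_deriv f \<psi>)
  show "integrable lborel (\<lambda>x. laplacian f x * \<psi> x)"
    unfolding eq by (intro Bochner_Integration.integrable_sum I1)
  have "(\<integral>x. partial_deriv i (partial_deriv i f) x * \<psi> x \<partial>lborel) =
     (\<integral>x. f x * partial_deriv i (partial_deriv i \<psi>) x \<partial>lborel)" for i
    using integral_mult_partial_deriv(1)[OF smooth_partial_deriv[OF f] \<psi>, of i i]
      integral_mult_partial_deriv(1)[OF f test_fun_partial_deriv[OF \<psi>], of i i] by simp
  then show "(\<integral>x. laplacian f x * \<psi> x \<partial>lborel) = (\<integral>x. f x * laplacian \<psi> x \<partial>lborel)"
    unfolding eq using I1 I2
    by (simp add: laplacian_def sum_distrib_left Bochner_Integration.integral_sum)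
qed

section \<open>Convolutions: derivatives, uniform decay and limits\<close>

lemma integral_reflect:
  fixes f :: "'a::euclidean_space \<Rightarrow> 'b::{banach,second_countable_topology}"
  assumes "f \<in> borel_measurable borel"
  shows "(\<integral>y. f (x - y) \<partial>lborel) = (\<integral>y. f y \<partial>lborel)"
    and "integrable lborel f \<Longrightarrow> integrable lborel (\<lambda>y. f (x - y))"
proof -
  have d: "distr lborel borel (\<lambda>y. x - y) = (lborel :: 'a measure)"
    using lborel_affine[of "-1" x] by (simp add: density_1)
  have m: "(\<lambda>y. x - y) \<in> lborel \<rightarrow>\<^sub>M borel" by measurable
  show "(\<integral>y. f (x - y) \<partial>lborel) = (\<integral>y. f y \<partial>lborel)"
    using integral_distr[OF m assms] by (simp add: d)
  show "integrable lborel f \<Longrightarrow> integrable lborel (\<lambda>y. f (x - y))"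
    using integrable_distr[OF m, of f] by (simp add: d)
qed

definition conv :: "(real^'n::finite \<Rightarrow> complex) \<Rightarrow> (real^'n \<Rightarrow> complex) \<Rightarrow> real^'n \<Rightarrow> complex" where
  "conv f \<phi> x = (\<integral>y. f y * \<phi> (x - y) \<partial>lborel)"

lemma integrable_conv:
  assumes f: "integrable lborel f" and \<phi>: "test_fun \<phi>"
  shows "integrable lborel (\<lambda>y. f y * \<phi> (x - y))"
proof -
  obtain B where B: "B > 0" "\<And>p x. norm (\<phi> x) \<le> B"
    using decays_bounded[OF test_fun_decays[OF \<phi>]] by metis
  have [measurable]: "\<phi> \<in> borel_measurable borel" by (rule borel_measurable_test_fun[OF \<phi>])
  have [measurable]: "f \<in> borel_measurable borel" using f by auto
  show ?thesis
    by (rule Bochner_Integration.integrable_bound[OF integrable_mult_left[OF f, of "of_real B"]])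
      (use B in \<open>auto simp: norm_mult intro!: mult_left_mono\<close>)
qed

lemma borel_measurable_conv:
  fixes f \<phi> :: "real^'n::finite \<Rightarrow> complex"
  assumes [measurable]: "f \<in> borel_measurable borel" "\<phi> \<in> borel_measurable borel"
  shows "conv f \<phi> \<in> borel_measurable borel"
proof -
  have "(\<lambda>x. \<integral>y. f y * \<phi> (x - y) \<partial>lborel) \<in> borel_measurable borel" by measurable
  then show ?thesis unfolding conv_def[abs_def] .
qed

text \<open>The derivative falls on the kernel, and |f| times a bound for the differentiated kernel
  dominates.\<close>

lemma has_vector_derivative_conv:
  assumes f: "integrable lborel f" and \<phi>: "test_fun \<phi>"
  shows "((\<lambda>h. conv f \<phi> (x + h *\<^sub>R axis i 1)) has_vector_derivative conv f (partial_deriv i \<phi>) x) (at 0)"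
proof -
  note \<phi>' = test_fun_partial_deriv[OF \<phi>, of i]
  obtain B where B: "B > 0" "\<And>x. norm (partial_deriv i \<phi> x) \<le> B"
    using decays_bounded[OF test_fun_decays[OF \<phi>']] by metis
  have sm: "smooth \<phi>" using \<phi> by (simp add: test_fun_def)
  have "((\<lambda>h. \<integral>y. f y * \<phi> (x + h *\<^sub>R axis i 1 - y) \<partial>lborel) has_vector_derivative
     (\<integral>y. f y * partial_deriv i \<phi> (x + 0 *\<^sub>R axis i 1 - y) \<partial>lborel)) (at 0)"
  proof (rule has_vector_derivative_integral_dominated[where e = 1])
    show "((\<lambda>h. f y * \<phi> (x + h *\<^sub>R axis i 1 - y)) has_vector_derivative
        f y * partial_deriv i \<phi> (x + s *\<^sub>R axis i 1 - y)) (at s)" for y s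
    proof -
      have "((\<lambda>h. \<phi> ((x - y) + h *\<^sub>R axis i 1)) has_vector_derivative
        partial_deriv i \<phi> ((x - y) + s *\<^sub>R axis i 1)) (at s)"
        by (rule has_vector_derivative_line_at[OF smooth_has_partial_deriv[OF sm]])
      then show ?thesis by (intro has_vector_derivative_mult_right) (simp add: algebra_simps)
    qed
    show "norm (f y * partial_deriv i \<phi> (x + s *\<^sub>R axis i 1 - y)) \<le> norm (f y) * B" for y s
      using B by (simp add: norm_mult mult_left_mono)
    show "integrable lborel (\<lambda>y. norm (f y) * B)" using f by simp
    show "integrable lborel (\<lambda>y. f y * \<phi> (x + s *\<^sub>R axis i 1 - y))" for s
      by (rule integrable_conv[OF f \<phi>])
  qed simp
  then show ?thesis by (simp add: conv_def)
qed

text \<open>Within the support of the kernel |y| >= |x| - R, which costs the factor exp (c R). The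
  kernel enters the bound only through its support radius and its mass; both stay bounded while
  mollifiers concentrate, so the decay is uniform over all of them.\<close>

lemma decays_conv:
  fixes F :: "'p \<Rightarrow> real^'n::finite \<Rightarrow> complex" and \<Phi> :: "'q \<Rightarrow> real^'n \<Rightarrow> complex"
  assumes F: "decays F" and supp: "\<And>q x. norm x > R \<Longrightarrow> \<Phi> q x = 0"
    and \<Phi>: "\<And>q. test_fun (\<Phi> q)" and B: "\<And>q. (\<integral>x. cmod (\<Phi> q x) \<partial>lborel) \<le> B"
  shows "decays (\<lambda>p. conv (F (fst p)) (\<Phi> (snd p)))"
proof -
  obtain K c where *: "K > 0" "c > 0" "\<And>p x. norm (F p x) \<le> K * exp (- c * norm x)"
    using F unfolding decays_def by blast
  show ?thesis
  proof (rule decaysI[OF *(2), where K = "K * exp (c * R) * B"])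
    fix p :: "'p \<times> 'q" and x :: "real^'n"
    obtain a q where p: "p = (a, q)" by force
    have m: "(\<lambda>x. cmod (\<Phi> q x)) \<in> borel_measurable borel"
      using borel_measurable_test_fun[OF \<Phi>] by measurable
    have i: "integrable lborel (\<lambda>x. cmod (\<Phi> q x))"
      using decays_integrable[OF test_fun_decays[OF \<Phi>]] borel_measurable_test_fun[OF \<Phi>] by simp
    let ?C = "K * exp (c * R) * exp (- c * norm x)"
    have "norm (conv (F a) (\<Phi> q) x) \<le> (\<integral>y. norm (F a y * \<Phi> q (x - y)) \<partial>lborel)"
      unfolding conv_def by (rule integral_norm_bound)
    also have "\<dots> \<le> (\<integral>y. ?C * cmod (\<Phi> q (x - y)) \<partial>lborel)"
    proof (rule integral_mono')
      show "integrable lborel (\<lambda>y. ?C * cmod (\<Phi> q (x - y)))"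
        by (intro integrable_mult_right integral_reflect(2)[OF m i])
      show "norm (F a y * \<Phi> q (x - y)) \<le> ?C * cmod (\<Phi> q (x - y))" for y
      proof (cases "norm (x - y) > R")
        case False
        then have "norm x - R \<le> norm y" using norm_triangle_ineq2[of x y] by simp
        then have "K * exp (- c * norm y) \<le> K * exp (- c * (norm x - R))"
          using * by (intro mult_left_mono) auto
        also have "\<dots> = ?C" by (simp add: exp_add[symmetric] algebra_simps)
        finally have "norm (F a y) \<le> ?C" using *(3)[of a y] by linarith
        then show ?thesis by (simp add: norm_mult mult_right_mono)
      qed (simp add: supp)
    qed (use * in auto)
    also have "\<dots> = ?C * (\<integral>y. cmod (\<Phi> q y) \<partial>lborel)"
      using integral_reflect(1)[OF m, of x] by simp
    also have "\<dots> \<le> ?C * B" using * by (intro mult_left_mono B) auto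
    finally show "norm (conv (F (fst p)) (\<Phi> (snd p)) x) \<le> K * exp (c * R) * B * exp (- c * norm x)"
      by (simp add: p mult_ac)
  qed
qed

lemma decays_conv_fixed:
  assumes "decays F" "test_fun \<phi>"
  shows "decays (\<lambda>p. conv (F p) \<phi>)"
proof -
  obtain R where R: "\<And>x. norm x > R \<Longrightarrow> \<phi> x = 0" using test_fun_support[OF assms(2)] by blast
  have "decays (\<lambda>p. conv (F (fst p)) ((\<lambda>_::unit. \<phi>) (snd p)))"
    using assms R by (intro decays_conv) auto
  from decays_reparam[OF this, of "\<lambda>p. (p, ())"] show ?thesis by simp
qed

text \<open>As the kernel has mass 1, f(x) is the integral of f(x) times the kernel, and f(y) is
  close to f(x) on the shrinking support.\<close>

lemma conv_mollifier_tendsto: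
  fixes f :: "real^'n::finite \<Rightarrow> complex"
  assumes f: "integrable lborel f" "isCont f x" and \<Phi>: "\<And>k. mollifier (\<delta> k) (\<Phi> k)" and \<delta>: "\<delta> \<longlonglongrightarrow> 0"
  shows "(\<lambda>k::nat. conv f (\<Phi> k) x) \<longlonglongrightarrow> f x"
proof (rule tendstoI)
  fix e :: real assume e: "e > 0"
  obtain d where d: "d > 0" "\<And>y. dist y x < d \<Longrightarrow> dist (f y) (f x) < e / 2"
    using f(2) e unfolding continuous_at_eps_delta by (meson half_gt_zero)
  have ev: "eventually (\<lambda>k. \<delta> k < d) sequentially"
    using \<delta> d(1) by (rule order_tendstoD)
  show "eventually (\<lambda>k. dist (conv f (\<Phi> k) x) (f x) < e) sequentially"
    using ev
  proof (rule eventually_mono)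
    fix k assume k: "\<delta> k < d"
    have t: "test_fun (\<Phi> k)" and supp: "\<And>x. norm x > \<delta> k \<Longrightarrow> \<Phi> k x = 0"
      and re: "\<And>x. \<Phi> k x = complex_of_real (cmod (\<Phi> k x))" and one: "(\<integral>x. cmod (\<Phi> k x) \<partial>lborel) = 1"
      using \<Phi>[of k] unfolding mollifier_def by blast+
    have m: "\<Phi> k \<in> borel_measurable borel" "(\<lambda>x. cmod (\<Phi> k x)) \<in> borel_measurable borel"
      using borel_measurable_test_fun[OF t] by measurable
    have i: "integrable lborel (\<Phi> k)"
      using decays_integrable[OF test_fun_decays[OF t]] m by simp
    have ir: "integrable lborel (\<lambda>y. \<Phi> k (x - y))" by (rule integral_reflect(2)[OF m(1) i])
    \<comment> \<open>A mollifier equals its modulus pointwise, so its complex integral is the mass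
      1 as well.\<close>
    have "(\<integral>y. \<Phi> k (x - y) \<partial>lborel) = (\<integral>y. complex_of_real (cmod (\<Phi> k y)) \<partial>lborel)"
      unfolding integral_reflect(1)[OF m(1)]
      by (rule Bochner_Integration.integral_cong[OF refl]) (rule re)
    also have "\<dots> = 1" using one by (simp del: of_real_eq_iff add: integral_complex_of_real)
    finally have "f x = (\<integral>y. f x * \<Phi> k (x - y) \<partial>lborel)" by simp
    then have "conv f (\<Phi> k) x - f x = (\<integral>y. f y * \<Phi> k (x - y) \<partial>lborel) - (\<integral>y. f x * \<Phi> k (x - y) \<partial>lborel)"
      by (simp add: conv_def)
    also have "\<dots> = (\<integral>y. f y * \<Phi> k (x - y) - f x * \<Phi> k (x - y) \<partial>lborel)"
      by (intro Bochner_Integration.integral_diff[symmetric] integrable_conv f t integrable_mult_right ir)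
    finally have "norm (conv f (\<Phi> k) x - f x) \<le> (\<integral>y. norm (f y * \<Phi> k (x - y) - f x * \<Phi> k (x - y)) \<partial>lborel)"
      by (simp only: integral_norm_bound)
    also have "\<dots> \<le> (\<integral>y. e / 2 * cmod (\<Phi> k (x - y)) \<partial>lborel)"
    proof (rule integral_mono')
      show "integrable lborel (\<lambda>y. e / 2 * cmod (\<Phi> k (x - y)))"
        using ir by (intro integrable_mult_right integrable_norm)
      show "norm (f y * \<Phi> k (x - y) - f x * \<Phi> k (x - y)) \<le> e / 2 * cmod (\<Phi> k (x - y))" for y
      proof (cases "norm (x - y) > \<delta> k")
        case False
        then have "dist y x < d" using k by (simp add: dist_norm norm_minus_commute)
        then have "norm (f y - f x) \<le> e / 2" using d(2)[of y] by (simp add: dist_norm)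
        then show ?thesis
          unfolding left_diff_distrib[symmetric] norm_mult by (rule mult_right_mono) simp
      qed (simp add: supp)
    qed (use e in auto)
    also have "\<dots> = e / 2" using integral_reflect(1)[OF m(2), of x] one by simp
    finally show "dist (conv f (\<Phi> k) x) (f x) < e" using e by (simp add: dist_norm)
  qed
qed

text \<open>Testing against the reflected kernel and moving the Laplacian onto it shows that v = u *
  phi satisfies i v_t + Laplacian v = f(u) * phi at each fixed x, with f the nonlinearity and v_t a
  genuine derivative.\<close>

lemma has_vector_derivative_conv_time:
  fixes u ut :: "real \<Rightarrow> real^'n::finite \<Rightarrow> complex"
  assumes wt: "weak_time_deriv u ut" and eq: "\<And>t x. \<i> * ut t x + laplacian (u t) x = log_nonlin (u t x)"
    and sm: "\<And>t. smooth (u t)" and g: "\<And>t. integrable lborel (\<lambda>x. log_nonlin (u t x))"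
    and \<phi>: "test_fun \<phi>"
  shows "((\<lambda>s. conv (u s) \<phi> x) has_vector_derivative
     \<i> * ((\<Sum>j\<in>UNIV. conv (u t) (partial_deriv j (partial_deriv j \<phi>)) x) - conv (\<lambda>y. log_nonlin (u t y)) \<phi> x)) (at t)"
proof -
  let ?\<psi> = "\<lambda>y. \<phi> (x - y)"
  have \<psi>: "test_fun ?\<psi>" by (rule test_fun_reflect[OF \<phi>])
  have sm\<phi>: "smooth \<phi>" using \<phi> by (simp add: test_fun_def)
  \<comment> \<open>Each reflected derivative contributes a sign -1; at order two the signs
    cancel.\<close>
  have lap: "laplacian ?\<psi> y = (\<Sum>j\<in>UNIV. partial_deriv j (partial_deriv j \<phi>) (x - y))" for y
    unfolding laplacian_def iter_partial_reflect[OF sm\<phi>] by simp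
  have ut: "ut t y = \<i> * laplacian (u t) y - \<i> * log_nonlin (u t y)" for y
  proof -
    have "\<i> * (\<i> * ut t y + laplacian (u t) y) = \<i> * log_nonlin (u t y)" by (simp only: eq)
    then show ?thesis by (simp add: algebra_simps)
  qed
  have ii: "integrable lborel (\<lambda>y. u t y * partial_deriv j (partial_deriv j \<phi>) (x - y))" for j
    by (intro integral_mult_partial_deriv(2) test_fun_reflect test_fun_partial_deriv sm \<phi>)
  have "(\<integral>y. ut t y * ?\<psi> y \<partial>lborel) = (\<integral>y. \<i> * (laplacian (u t) y * ?\<psi> y) - \<i> * (log_nonlin (u t y) * ?\<psi> y) \<partial>lborel)"
    by (simp add: ut algebra_simps)
  also have "\<dots> = \<i> * (\<integral>y. laplacian (u t) y * ?\<psi> y \<partial>lborel) - \<i> * (\<integral>y. log_nonlin (u t y) * ?\<psi> y \<partial>lborel)"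
    using integral_laplacian_mult(2)[OF sm \<psi>] integrable_conv[OF g \<phi>]
    by (subst Bochner_Integration.integral_diff) auto
  also have "(\<integral>y. laplacian (u t) y * ?\<psi> y \<partial>lborel) = (\<Sum>j\<in>UNIV. conv (u t) (partial_deriv j (partial_deriv j \<phi>)) x)"
    unfolding integral_laplacian_mult(1)[OF sm \<psi>] lap conv_def sum_distrib_left
    by (intro Bochner_Integration.integral_sum ii)
  finally have "(\<integral>y. ut t y * ?\<psi> y \<partial>lborel) = \<i> * ((\<Sum>j\<in>UNIV. conv (u t) (partial_deriv j (partial_deriv j \<phi>)) x) - conv (\<lambda>y. log_nonlin (u t y)) \<phi> x)"
    by (simp add: conv_def algebra_simps)
  moreover have "((\<lambda>s. \<integral>y. u s y * ?\<psi> y \<partial>lborel) has_vector_derivative (\<integral>y. ut t y * ?\<psi> y \<partial>lborel)) (at t)"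
    using wt \<psi> unfolding weak_time_deriv_def by blast
  ultimately show ?thesis unfolding conv_def by simp
qed

section \<open>The virial identity\<close>

lemma has_vector_derivative_Re_mult_cnj:
  assumes "(f has_vector_derivative f') (at t)" "(g has_vector_derivative g') (at t)"
  shows "((\<lambda>s. Re (f s * cnj (g s))) has_vector_derivative
     Re (f' * cnj (g t)) + Re (f t * cnj g')) (at t)"
proof -
  have "((\<lambda>s. cnj (g s)) has_vector_derivative cnj g') (at t)"
    by (rule bounded_linear.has_vector_derivative[OF bounded_linear_cnj assms(2)])
  from bounded_linear.has_vector_derivative[OF bounded_linear_Re has_vector_derivative_mult[OF assms(1) this]]
  show ?thesis by (simp add: algebra_simps)
qed

lemma has_vector_derivative_coord:
  assumes "(f has_vector_derivative f') (at (0::real))"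
  shows "((\<lambda>h. (x + h *\<^sub>R axis j 1 :: real^'n::finite) $ i * f h) has_vector_derivative
    (if i = j then f 0 else 0) + (x $ i) * (f'::real)) (at 0)"
proof -
  have "((\<lambda>h. (x + h *\<^sub>R axis j 1) $ i) has_vector_derivative (if i = j then 1 else 0)) (at (0::real))"
    by (auto simp: axis_def intro!: derivative_eq_intros)
  from has_vector_derivative_mult[OF this assms] show ?thesis
    by (rule has_vector_derivative_eq_rhs) (auto simp: axis_def)
qed

text \<open>The expression contains values of \<open>v\<close> and \<open>d\<close> but no
  derivatives; this is what permits a bound uniform in the mollification radius.\<close>

lemma decays_virial_bound:
  fixes n :: real
  assumes v: "decays v" and d: "decays d"
  shows "decays (\<lambda>p x. n * (norm (v p x))\<^sup>2 - (norm x * norm (d p x))\<^sup>2 / 2 - n * (norm (d p x) * norm (v p x)))"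
proof -
  have dv: "decays (\<lambda>p x. norm (v p x))" by (rule decays_mono[OF v, of _ 1]) simp
  have dd: "decays (\<lambda>p x. norm (d p x))" by (rule decays_mono[OF d, of _ 1]) simp
  have dn: "decays (\<lambda>p x. norm x * norm (d p x))" by (rule decays_norm_mult[OF d])
  have "decays (\<lambda>p x. n * (norm (v p x) * norm (v p x)) - 1/2 * ((norm x * norm (d p x)) * (norm x * norm (d p x)))
      - n * (norm (d p x) * norm (v p x)))"
    by (rule decays_diff[OF decays_diff[OF decays_cmult_real[OF decays_mult[OF dv dv]]
          decays_cmult_real[OF decays_mult[OF dn dn]]] decays_cmult_real[OF decays_mult[OF dd dv]]])
  then show ?thesis by (simp add: power2_eq_square)
qed

text \<open>Read \<open>v1\<close> and \<open>v2\<close> as first and second derivatives of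
  \<open>v\<close>, \<open>w\<close> as the mollified nonlinearity, and \<open>q\<close> as
  Laplacian v - w, so that v_t = i q. The left side is then the time derivative of Im of the
  integral of cnj v (x . grad v). Up to divergences of decaying fields its integrand is the virial
  density with commutator error, and completing the square removes the gradient.\<close>

lemma virial_lower_bound:
  fixes v w q :: "'p \<Rightarrow> real^'n::finite \<Rightarrow> complex"
    and v1 q1 :: "'n \<Rightarrow> 'p \<Rightarrow> real^'n \<Rightarrow> complex"
    and v2 :: "'n \<Rightarrow> 'n \<Rightarrow> 'p \<Rightarrow> real^'n \<Rightarrow> complex"
  assumes dec: "decays v" "\<And>i. decays (v1 i)" "\<And>i j. decays (v2 i j)" "decays w" "decays q" "\<And>i. decays (q1 i)"
      "decays (\<lambda>p x. log_nonlin (v p x))"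
    and meas: "\<And>p. v p \<in> borel_measurable borel" "\<And>i p. v1 i p \<in> borel_measurable borel"
      "\<And>i j p. v2 i j p \<in> borel_measurable borel" "\<And>p. w p \<in> borel_measurable borel"
      "\<And>p. q p \<in> borel_measurable borel" "\<And>i p. q1 i p \<in> borel_measurable borel"
    and der: "\<And>i p x. ((\<lambda>h. v p (x + h *\<^sub>R axis i 1)) has_vector_derivative v1 i p x) (at 0)"
      "\<And>i j p x. ((\<lambda>h. v1 i p (x + h *\<^sub>R axis j 1)) has_vector_derivative v2 j i p x) (at 0)"
      "\<And>i p x. ((\<lambda>h. q p (x + h *\<^sub>R axis i 1)) has_vector_derivative q1 i p x) (at 0)"
    and sym: "\<And>i j. v2 i j = v2 j i"
    and q: "\<And>p x. q p x = (\<Sum>j\<in>UNIV. v2 j j p x) - w p x"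
  shows "(\<integral>x. (\<Sum>i\<in>UNIV. x $ i * (Re (q1 i p x * cnj (v p x)) - Re (q p x * cnj (v1 i p x)))) \<partial>lborel)
     \<ge> (\<integral>x. CARD('n) * (cmod (v p x))\<^sup>2 - (norm x * cmod (w p x - log_nonlin (v p x)))\<^sup>2 / 2
           - CARD('n) * (cmod (w p x - log_nonlin (v p x)) * cmod (v p x)) \<partial>lborel)"
proof -
  let ?n = "real CARD('n)"
  define R where "R F G p x = Re (F p x * cnj (G p x :: complex))" for F G and p :: 'p and x :: "real^'n"
  define g where "g = (\<lambda>p x. log_nonlin (v p x))"
  define d where "d = (\<lambda>p x. w p x - g p x)"
  have [measurable]: "log_nonlin \<in> borel_measurable borel"
    by (intro borel_measurable_continuous_onI continuous_on_log_nonlin)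
  have [measurable]: "(\<lambda>x::real^'n. x $ i) \<in> borel_measurable borel" for i
    by (intro borel_measurable_continuous_onI continuous_intros)
  have [measurable]: "cnj \<in> borel_measurable borel"
    by (intro borel_measurable_continuous_onI continuous_intros)
  note [measurable] = meas
  have [measurable]: "g p \<in> borel_measurable borel" "d p \<in> borel_measurable borel" for p
    unfolding g_def d_def by measurable
  have R_meas [measurable]: "R F G p \<in> borel_measurable borel"
    if [measurable]: "F p \<in> borel_measurable borel" "G p \<in> borel_measurable borel" for F G p
    unfolding R_def by measurable
  have decg: "decays g" using dec(7) by (simp add: g_def)
  have decd: "decays d" unfolding d_def by (intro decays_diff dec decg)
  have R_self: "R F F p x = (cmod (F p x))\<^sup>2" for F p x
    unfolding R_def complex_norm_square[symmetric] by (rule Re_complex_of_real)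
  have R_dec: "decays (R F G)" if "decays F" "decays G" for F G
    unfolding R_def by (rule decays_Re_mult_cnj[OF that])
  have R_der: "((\<lambda>h. R F G p (x + h *\<^sub>R axis i 1)) has_vector_derivative R F' G p x + R F G' p x) (at 0)"
    if "((\<lambda>h. F p (x + h *\<^sub>R axis i 1)) has_vector_derivative F' p x) (at 0)"
       "((\<lambda>h. G p (x + h *\<^sub>R axis i 1)) has_vector_derivative G' p x) (at 0)" for F G F' G' and i p x
    using has_vector_derivative_Re_mult_cnj[OF that] by (simp add: R_def)
  note decs = dec R_dec decays_add decays_diff decays_sum decays_cmult_real decays_coord_real decays_zero decg decd
  have decs_if: "decays (\<lambda>p x. if b then F p x else 0)" if "decays F" for b and F :: "'p \<Rightarrow> real^'n \<Rightarrow> real"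
    using that decays_zero by (cases b) auto

  \<comment> \<open>The five families are expanded divergences. With \<open>D_i\<close> the partial
    derivative, F the potential and n the dimension they are: \<open>Z1\<close> =
    \<open>D_i (x_i Re (v cnj q))\<close>, \<open>Za\<close> =
    \<open>-2 D_j (x_i Re (D_j v cnj D_i v))\<close>, \<open>Zb\<close> =
    \<open>D_i (x_i |D_j v|^2)\<close>, \<open>Zc\<close> = \<open>-n D_j Re (D_j v cnj v)\<close>,
    \<open>Zd\<close> = \<open>D_i (x_i F(v))\<close>.\<close>
  define Z1 where "Z1 i p x = R v q p x + x $ i * (R (v1 i) q p x + R v (q1 i) p x)" for i p x
  define Za where "Za i j p x = -2 * ((if i = j then R (v1 j) (v1 i) p x else 0)
      + x $ i * (R (v2 j j) (v1 i) p x + R (v1 j) (v2 j i) p x))" for i j p x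
  define Zb where "Zb i j p x = R (v1 j) (v1 j) p x + x $ i * (R (v2 i j) (v1 j) p x + R (v1 j) (v2 i j) p x)" for i j p x
  define Zc where "Zc j p x = - ?n * (R (v2 j j) v p x + R (v1 j) (v1 j) p x)" for j p x
  define Zd where "Zd i p x = (R g v p x - R v v p x) + x $ i * (2 * R g (v1 i) p x)" for i p x

  have Z1_0: "integral\<^sup>L lborel (Z1 i p) = 0" and Z1_int: "integrable lborel (Z1 i p)" for i
  proof -
    have D: "decays (Z1 i)" unfolding Z1_def by (intro decs)
    have M: "Z1 i p \<in> borel_measurable lborel" unfolding Z1_def by measurable
    show "integrable lborel (Z1 i p)" by (rule decays_integrable[OF D M])
    show "integral\<^sup>L lborel (Z1 i p) = 0"
    proof (rule integral_directional_derivative_eq_0[where F = "\<lambda>p x. x $ i * R v q p x" and e = "axis i 1", OF _ D])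
      show "decays (\<lambda>p x. x $ i * R v q p x)" by (intro decs)
      show "(\<lambda>x. x $ i * R v q p x) \<in> borel_measurable borel" by measurable
      show "((\<lambda>h. (x + h *\<^sub>R axis i 1) $ i * R v q p (x + h *\<^sub>R axis i 1)) has_vector_derivative Z1 i p x) (at 0)" for x
        using has_vector_derivative_coord[OF R_der[of v p x i "v1 i" q "q1 i"], of x i i] der by (simp add: Z1_def)
    qed
  qed
  have Za_0: "integral\<^sup>L lborel (Za i j p) = 0" and Za_int: "integrable lborel (Za i j p)" for i j
  proof -
    have D: "decays (Za i j)" unfolding Za_def by (intro decs decs_if)
    have M: "Za i j p \<in> borel_measurable lborel" unfolding Za_def by measurable
    show "integrable lborel (Za i j p)" by (rule decays_integrable[OF D M])
    show "integral\<^sup>L lborel (Za i j p) = 0"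
    proof (rule integral_directional_derivative_eq_0[where F = "\<lambda>p x. -2 * (x $ i * R (v1 j) (v1 i) p x)" and e = "axis j 1", OF _ D])
      show "decays (\<lambda>p x. -2 * (x $ i * R (v1 j) (v1 i) p x))" by (intro decs)
      show "(\<lambda>x. -2 * (x $ i * R (v1 j) (v1 i) p x)) \<in> borel_measurable borel" by measurable
      show "((\<lambda>h. -2 * ((x + h *\<^sub>R axis j 1) $ i * R (v1 j) (v1 i) p (x + h *\<^sub>R axis j 1))) has_vector_derivative Za i j p x) (at 0)" for x
        unfolding Za_def
      proof (rule has_vector_derivative_mult_right)
        show "((\<lambda>h. (x + h *\<^sub>R axis j 1) $ i * R (v1 j) (v1 i) p (x + h *\<^sub>R axis j 1)) has_vector_derivative
           (if i = j then R (v1 j) (v1 i) p x else 0) + x $ i * (R (v2 j j) (v1 i) p x + R (v1 j) (v2 j i) p x)) (at 0)"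
          using has_vector_derivative_coord[OF R_der[of "v1 j" p x j "v2 j j" "v1 i" "v2 j i", OF der(2) der(2)], of x j i]
          unfolding scaleR_zero_left add_0_right .
      qed
    qed
  qed
  have Zb_0: "integral\<^sup>L lborel (Zb i j p) = 0" and Zb_int: "integrable lborel (Zb i j p)" for i j
  proof -
    have D: "decays (Zb i j)" unfolding Zb_def by (intro decs)
    have M: "Zb i j p \<in> borel_measurable lborel" unfolding Zb_def by measurable
    show "integrable lborel (Zb i j p)" by (rule decays_integrable[OF D M])
    show "integral\<^sup>L lborel (Zb i j p) = 0"
    proof (rule integral_directional_derivative_eq_0[where F = "\<lambda>p x. x $ i * R (v1 j) (v1 j) p x" and e = "axis i 1", OF _ D])
      show "decays (\<lambda>p x. x $ i * R (v1 j) (v1 j) p x)" by (intro decs)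
      show "(\<lambda>x. x $ i * R (v1 j) (v1 j) p x) \<in> borel_measurable borel" by measurable
      show "((\<lambda>h. (x + h *\<^sub>R axis i 1) $ i * R (v1 j) (v1 j) p (x + h *\<^sub>R axis i 1)) has_vector_derivative Zb i j p x) (at 0)" for x
        using has_vector_derivative_coord[OF R_der[of "v1 j" p x i "v2 i j" "v1 j" "v2 i j"], of x i i] der by (simp add: Zb_def)
    qed
  qed
  have Zc_0: "integral\<^sup>L lborel (Zc j p) = 0" and Zc_int: "integrable lborel (Zc j p)" for j
  proof -
    have D: "decays (Zc j)" unfolding Zc_def by (intro decs)
    have M: "Zc j p \<in> borel_measurable lborel" unfolding Zc_def by measurable
    show "integrable lborel (Zc j p)" by (rule decays_integrable[OF D M])
    show "integral\<^sup>L lborel (Zc j p) = 0"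
    proof (rule integral_directional_derivative_eq_0[where F = "\<lambda>p x. - ?n * R (v1 j) v p x" and e = "axis j 1", OF _ D])
      show "decays (\<lambda>p x. - ?n * R (v1 j) v p x)" by (intro decs)
      show "(\<lambda>x. - ?n * R (v1 j) v p x) \<in> borel_measurable borel" by measurable
      show "((\<lambda>h. - ?n * R (v1 j) v p (x + h *\<^sub>R axis j 1)) has_vector_derivative Zc j p x) (at 0)" for x
        unfolding Zc_def
        by (intro has_vector_derivative_mult_right R_der der)
    qed
  qed
  have Zd_0: "integral\<^sup>L lborel (Zd i p) = 0" and Zd_int: "integrable lborel (Zd i p)" for i
  proof -
    have D: "decays (Zd i)" unfolding Zd_def by (intro decs)
    have M: "Zd i p \<in> borel_measurable lborel" unfolding Zd_def by measurable
    have F: "log_potential (v p x) = R g v p x - R v v p x" for p x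
      unfolding R_self by (simp add: log_potential_def R_def g_def)
    show "integrable lborel (Zd i p)" by (rule decays_integrable[OF D M])
    show "integral\<^sup>L lborel (Zd i p) = 0"
    proof (rule integral_directional_derivative_eq_0[where F = "\<lambda>p x. x $ i * (R g v p x - R v v p x)" and e = "axis i 1", OF _ D])
      show "decays (\<lambda>p x. x $ i * (R g v p x - R v v p x))" by (intro decs)
      show "(\<lambda>x. x $ i * (R g v p x - R v v p x)) \<in> borel_measurable borel" by measurable
      show "((\<lambda>h. (x + h *\<^sub>R axis i 1) $ i * (R g v p (x + h *\<^sub>R axis i 1) - R v v p (x + h *\<^sub>R axis i 1)))
          has_vector_derivative Zd i p x) (at 0)" for x
        unfolding F[symmetric]
        using has_vector_derivative_coord[OF has_vector_derivative_log_potential[OF der(1)[of p x i]], of x i i]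
        by (simp add: Zd_def F R_def g_def)
    qed
  qed

  define P where "P x = (\<Sum>i\<in>UNIV. x $ i * (R (q1 i) v p x - R q (v1 i) p x))" for x
  \<comment> \<open>\<open>B\<close> is the density 2 |grad v|^2 + n |v|^2 together with the error
    Re (d (2 x . grad (cnj v) + n cnj v)).\<close>
  define B where "B x = (\<Sum>i\<in>UNIV. 2 * R (v1 i) (v1 i) p x + x $ i * (2 * R d (v1 i) p x))
      + ?n * R v v p x + ?n * R d v p x" for x
  define Lo where "Lo x = ?n * (cmod (v p x))\<^sup>2 - (norm x * cmod (d p x))\<^sup>2 / 2 - ?n * (cmod (d p x) * cmod (v p x))" for x
  have "decays (\<lambda>p x. (\<Sum>i\<in>UNIV. 2 * R (v1 i) (v1 i) p x + x $ i * (2 * R d (v1 i) p x))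
      + ?n * R v v p x + ?n * R d v p x)" by (intro decs)
  then have B_int: "integrable lborel B"
    using decays_integrable[of _ p] unfolding B_def[abs_def] by fastforce
  note decays_virial_bound[OF dec(1) decd, of ?n]
  then have Lo_int: "integrable lborel Lo"
    unfolding Lo_def[abs_def] by (rule decays_integrable) measurable

  have P_eq: "P x = (\<Sum>i\<in>UNIV. Z1 i p x) + (\<Sum>j\<in>UNIV. \<Sum>i\<in>UNIV. Za i j p x + Zb i j p x)
      + (\<Sum>j\<in>UNIV. Zc j p x) + (\<Sum>i\<in>UNIV. Zd i p x) + B x" for x
  proof -
    define L where "L = (\<lambda>p x. \<Sum>j\<in>UNIV. v2 j j p x)"
    define T where "T F = (\<Sum>i\<in>UNIV. x $ i * R F (v1 i) p x)" for F
    define A where "A = (\<Sum>i\<in>UNIV. x $ i * R (q1 i) v p x)"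
    define N where "N = (\<Sum>i\<in>UNIV. R (v1 i) (v1 i) p x)"
    have comm: "R F G p x = R G F p x" for F G by (simp add: R_def mult.commute)
    have R_L: "R L F p x = (\<Sum>j\<in>UNIV. R (v2 j j) F p x)" for F
      by (simp add: R_def L_def sum_distrib_right)
    have TL: "(\<Sum>j\<in>UNIV. \<Sum>i\<in>UNIV. x $ i * R (v2 j j) (v1 i) p x) = T L"
      unfolding T_def R_L sum_distrib_left by (rule sum.swap)
    have q': "q = (\<lambda>p x. L p x - w p x)" by (simp add: fun_eq_iff q L_def)
    have Rq: "R q F p x = R L F p x - R w F p x" for F by (simp add: R_def q' left_diff_distrib)
    have Rd: "R d F p x = R w F p x - R g F p x" for F by (simp add: R_def d_def left_diff_distrib)
    have Tq: "T q = T L - T w" by (simp add: T_def Rq right_diff_distrib sum_subtractf)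
    have Td: "T d = T w - T g" by (simp add: T_def Rd right_diff_distrib sum_subtractf)
    have hP: "P x = A - T q" by (simp add: P_def A_def T_def right_diff_distrib sum_subtractf)
    have h1: "(\<Sum>i\<in>UNIV. Z1 i p x) = ?n * R q v p x + T q + A"
      by (simp add: Z1_def comm[of "v1 _" q] comm[of v "q1 _"] comm[of v q] T_def A_def distrib_left sum.distrib)
    \<comment> \<open>Symmetry of the second derivatives cancels the second terms of
      \<open>Za\<close> against those of \<open>Zb\<close>, leaving only first derivatives and the
      Laplacian.\<close>
    have "Za i j p x + Zb i j p x = R (v1 j) (v1 j) p x - 2 * (if i = j then R (v1 j) (v1 i) p x else 0)
       - 2 * (x $ i * R (v2 j j) (v1 i) p x)" for i j
      unfolding Za_def Zb_def sym[of j i] comm[of "v2 i j" "v1 j"] by (simp add: algebra_simps)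
    then have "(\<Sum>j\<in>UNIV. \<Sum>i\<in>UNIV. Za i j p x + Zb i j p x) = (\<Sum>j\<in>UNIV. \<Sum>i\<in>(UNIV::'n set). R (v1 j) (v1 j) p x)
       - 2 * (\<Sum>j\<in>UNIV. \<Sum>i\<in>UNIV. (if i = j then R (v1 j) (v1 i) p x else 0))
       - 2 * (\<Sum>j\<in>UNIV. \<Sum>i\<in>UNIV. x $ i * R (v2 j j) (v1 i) p x)"
      by (simp only: sum_subtractf sum_distrib_left)
    also have "\<dots> = ?n * N - 2 * N - 2 * T L"
      unfolding TL by (simp add: N_def sum_distrib_left)
    finally have h2: "(\<Sum>j\<in>UNIV. \<Sum>i\<in>UNIV. Za i j p x + Zb i j p x) = ?n * N - 2 * N - 2 * T L" .
    have h3: "(\<Sum>j\<in>UNIV. Zc j p x) = - ?n * R L v p x - ?n * N"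
      unfolding Zc_def R_L N_def sum_distrib_left[symmetric] sum.distrib by (simp add: algebra_simps)
    have h4: "(\<Sum>i\<in>UNIV. Zd i p x) = ?n * (R g v p x - R v v p x) + 2 * T g"
      by (simp add: Zd_def T_def sum.distrib sum_distrib_left mult_ac)
    have hB: "B x = 2 * N + 2 * T d + ?n * R v v p x + ?n * R d v p x"
      by (simp add: B_def N_def T_def sum.distrib sum_distrib_left mult_ac)
    show ?thesis
      unfolding hP h1 h2 h3 h4 hB Tq Td Rq Rd by (simp add: algebra_simps)
  qed
  have Zab_int: "integrable lborel (\<lambda>x. \<Sum>j\<in>UNIV. \<Sum>i\<in>UNIV. Za i j p x + Zb i j p x)"
    by (intro Bochner_Integration.integrable_sum Bochner_Integration.integrable_add Za_int Zb_int)
  have Zab_0: "(\<integral>x. (\<Sum>j\<in>UNIV. \<Sum>i\<in>UNIV. Za i j p x + Zb i j p x) \<partial>lborel) = 0"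
    by (simp add: Bochner_Integration.integral_sum Bochner_Integration.integrable_sum Za_int Zb_int Za_0 Zb_0)
  have "integral\<^sup>L lborel P = integral\<^sup>L lborel B"
    unfolding P_eq[abs_def]
    by (simp add: Zab_int Zab_0 Z1_int Zc_int Zd_int B_int Z1_0 Zc_0 Zd_0 Bochner_Integration.integrable_sum)
  also have "\<dots> \<ge> integral\<^sup>L lborel Lo"
  proof (rule integral_mono[OF Lo_int B_int])
    fix x
    have "- ((x $ i)\<^sup>2 * (cmod (d p x))\<^sup>2 / 2) \<le> 2 * R (v1 i) (v1 i) p x + x $ i * (2 * R d (v1 i) p x)" for i
    proof -
      let ?a = "cmod (v1 i p x)" and ?D = "cmod (d p x)"
      have "\<bar>x $ i * R d (v1 i) p x\<bar> \<le> \<bar>x $ i\<bar> * (?D * ?a)"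
        using abs_Re_le_cmod[of "d p x * cnj (v1 i p x)"]
        by (simp add: abs_mult R_def norm_mult mult_left_mono)
      then have "x $ i * (2 * R d (v1 i) p x) \<ge> - (2 * (\<bar>x $ i\<bar> * (?D * ?a)))" by linarith
      \<comment> \<open>The weights are chosen so that the term 2 |D_i v|^2 is used up exactly; this
        fixes the factor 1/2 in front of (|x| |d|)^2.\<close>
      moreover have "0 \<le> (2 * ?a - \<bar>x $ i\<bar> * ?D)\<^sup>2" by simp
      then have "2 * (\<bar>x $ i\<bar> * (?D * ?a)) \<le> 2 * ?a\<^sup>2 + (x $ i)\<^sup>2 * ?D\<^sup>2 / 2"
        by (simp add: power2_diff power_mult_distrib mult_ac)
      moreover note R_self[of "v1 i" p x]
      ultimately show ?thesis by linarith
    qed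
    then have "(\<Sum>i\<in>UNIV. - ((x $ i)\<^sup>2 * (cmod (d p x))\<^sup>2 / 2)) \<le> (\<Sum>i\<in>UNIV. 2 * R (v1 i) (v1 i) p x + x $ i * (2 * R d (v1 i) p x))"
      by (rule sum_mono)
    moreover have "(\<Sum>i\<in>UNIV. - ((x $ i)\<^sup>2 * (cmod (d p x))\<^sup>2 / 2)) = - ((norm x * cmod (d p x))\<^sup>2 / 2)"
    proof -
      have "(norm x)\<^sup>2 = (\<Sum>i\<in>UNIV. (x $ i)\<^sup>2)"
        unfolding power2_norm_eq_inner inner_vec_def by (simp add: power2_eq_square)
      then show ?thesis
        by (simp add: sum_negf sum_divide_distrib[symmetric] sum_distrib_right[symmetric] power_mult_distrib)
    qed
    moreover note R_self[of v p x]
    moreover have "\<bar>R d v p x\<bar> \<le> cmod (d p x) * cmod (v p x)"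
      using abs_Re_le_cmod[of "d p x * cnj (v p x)"] by (simp add: R_def norm_mult)
    then have "?n * (- (cmod (d p x) * cmod (v p x))) \<le> ?n * R d v p x"
      by (intro mult_left_mono) auto
    ultimately show "Lo x \<le> B x" unfolding Lo_def B_def by simp
  qed
  finally show ?thesis
    unfolding P_def[abs_def] Lo_def[abs_def] R_def d_def g_def by simp
qed

section \<open>Nonexistence of breathers\<close>

text \<open>The derivative is the pointwise limit of difference quotients with steps 1/(i + 1), each
  of which is continuous. This allows \<open>A k\<close> to be integrated although it may be
  discontinuous.\<close>

lemma borel_measurable_derivative:
  fixes f f' :: "real \<Rightarrow> real"
  assumes "\<And>x. (f has_real_derivative f' x) (at x)"
  shows "f' \<in> borel_measurable borel"
proof -
  have [measurable]: "f \<in> borel_measurable borel"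
    using assms by (intro borel_measurable_continuous_onI) (meson DERIV_isCont continuous_at_imp_continuous_on)
  show ?thesis
  proof (rule borel_measurable_LIMSEQ_real)
    fix x :: real
    have "filterlim (\<lambda>i. inverse (real (Suc i))) (at 0) sequentially"
      unfolding filterlim_at using LIMSEQ_inverse_real_of_nat by auto
    with assms[of x] show "(\<lambda>i. (f (x + inverse (real (Suc i))) - f x) / inverse (real (Suc i))) \<longlonglongrightarrow> f' x"
      unfolding DERIV_def by (rule filterlim_compose)
  qed measurable
qed

text \<open>Fatou's lemma for the nonnegative functions \<open>A k + M\<close>, whose integrals over the period are
  all equal to \<open>M * \<tau>\<close>.\<close>

lemma periodic_derivative_liminf:
  fixes P A lo :: "nat \<Rightarrow> real \<Rightarrow> real" and m :: "real \<Rightarrow> real"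
  assumes \<tau>: "\<tau> > 0" and P: "\<And>k t. (P k has_real_derivative A k t) (at t)"
    and per: "\<And>k. P k (t0 + \<tau>) = P k t0"
    and A: "\<And>k t. lo k t \<le> A k t" and bd: "\<And>k t. \<bar>lo k t\<bar> \<le> M"
    and lim: "\<And>t. (\<lambda>k. lo k t) \<longlonglongrightarrow> m t" and m: "\<And>t. m t \<ge> 0"
    and e: "e > 0" and pos: "\<And>t. \<bar>t - t0\<bar> < e \<Longrightarrow> m t > 0"
  shows False
proof -
  let ?S = "{t0..t0 + \<tau>}"
  have M: "M \<ge> 0" using bd[of 0 0] by linarith
  have AM: "A k t + M \<ge> 0" for k t using A[of k t] bd[of k t] by linarith
  have [measurable]: "A k \<in> borel_measurable borel" for k
    by (rule borel_measurable_derivative[OF P])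
  let ?f = "\<lambda>k t. ennreal (A k t + M) * indicator ?S t"
  let ?h = "\<lambda>t. liminf (\<lambda>k. ?f k t)"
  have int: "(\<integral>\<^sup>+t. ?f k t \<partial>lborel) = ennreal (M * \<tau>)" for k
  proof -
    have "(\<integral>\<^sup>+t. ?f k t \<partial>lborel) = ennreal ((P k (t0 + \<tau>) + M * (t0 + \<tau>)) - (P k t0 + M * t0))"
      using \<tau> AM by (intro nn_integral_FTC_Icc) (auto intro!: derivative_eq_intros P)
    also have "(P k (t0 + \<tau>) + M * (t0 + \<tau>)) - (P k t0 + M * t0) = M * \<tau>"
      unfolding per by (simp add: algebra_simps)
    finally show ?thesis .
  qed
  have "(\<integral>\<^sup>+t. ?h t \<partial>lborel) \<le> liminf (\<lambda>k. \<integral>\<^sup>+t. ?f k t \<partial>lborel)"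
    by (rule nn_integral_liminf) measurable
  then have upper: "(\<integral>\<^sup>+t. ?h t \<partial>lborel) \<le> ennreal (M * \<tau>)"
    unfolding int by (simp add: Liminf_const)
  have h: "?h t \<ge> ennreal (m t + M) * indicator ?S t" for t
  proof (cases "t \<in> ?S")
    case True
    have "(\<lambda>k. ennreal (lo k t + M)) \<longlonglongrightarrow> ennreal (m t + M)"
      by (intro tendsto_ennrealI tendsto_intros lim)
    then have "ennreal (m t + M) = liminf (\<lambda>k. ennreal (lo k t + M))"
      by (intro lim_imp_Liminf[symmetric]) auto
    also have "\<dots> \<le> liminf (\<lambda>k. ennreal (A k t + M))"
      using A by (intro Liminf_mono always_eventually) (auto intro!: ennreal_leI)
    finally show ?thesis using True by simp
  qed simp
  \<comment> \<open>On the period the lower limit is at least \<open>m t + M\<close>, hence at least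
    \<open>M\<close>, while its integral is at most that of the constant \<open>M\<close>. The two
    therefore agree almost everywhere.\<close>
  let ?c = "\<lambda>t. ennreal M * indicator ?S t"
  have c: "(\<integral>\<^sup>+t. ?c t \<partial>lborel) = ennreal (M * \<tau>)"
    using \<tau> M by (subst nn_integral_cmult_indicator) (auto simp: ennreal_mult)
  have hc: "?c t \<le> ?h t" for t
  proof -
    have "?c t \<le> ennreal (m t + M) * indicator ?S t"
      using m[of t] by (intro mult_right_mono ennreal_leI) auto
    then show ?thesis using h[of t] by (rule order_trans)
  qed
  have "(\<integral>\<^sup>+t. ?h t - ?c t \<partial>lborel) = (\<integral>\<^sup>+t. ?h t \<partial>lborel) - (\<integral>\<^sup>+t. ?c t \<partial>lborel)"
    by (rule nn_integral_diff) (use c hc in \<open>auto simp del: indicator_simps\<close>)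
  also have "\<dots> = 0" unfolding c by (rule diff_eq_0_ennreal[OF le_less_trans[OF upper ennreal_less_top] upper])
  finally have "AE t in lborel. ?h t - ?c t = 0"
    by (subst (asm) nn_integral_0_iff_AE) auto
  \<comment> \<open>Halving \<open>e\<close> keeps the closed interval strictly inside the region
    where \<open>m\<close> is positive, and the minimum keeps it inside the period; its length is
    still positive.\<close>
  then have "AE t in lborel. t \<notin> {t0..t0 + min (e / 2) \<tau>}"
  proof (rule AE_mp, intro AE_I2 impI notI)
    fix t assume z: "?h t - ?c t = 0" and t: "t \<in> {t0..t0 + min (e / 2) \<tau>}"
    then have S: "t \<in> ?S" and mt: "m t > 0" using e by (auto intro!: pos)
    have "ennreal (m t + M) \<le> ?h t" using h[of t] S by simp
    also have "?h t \<le> ?c t" using z by (rule ennreal_minus_eq_0)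
    also have "?c t = ennreal M" using S by simp
    finally show False using mt M by (simp add: ennreal_le_iff)
  qed
  then have "emeasure lborel {t0..t0 + min (e / 2) \<tau>} = 0"
    by (subst (asm) AE_iff_measurable[where N = "{t0..t0 + min (e / 2) \<tau>}"]) auto
  then show False using e \<tau> by (simp add: ennreal_eq_0_iff)
qed

text \<open>\<open>P\<close> is the virial functional of the mollified solution. At each time it
  depends only on the slice \<open>u t\<close>, so it inherits the period of \<open>u\<close>, and
  its derivative is bounded below by an integral free of gradients.\<close>

lemma virial_monotonicity:
  fixes u ut :: "real \<Rightarrow> real^'n::finite \<Rightarrow> complex"
  assumes wt: "weak_time_deriv u ut" and eq: "\<And>t x. \<i> * ut t x + laplacian (u t) x = log_nonlin (u t x)"
    and sm: "\<And>t. smooth (u t)" and dec: "decays u" and \<phi>: "test_fun \<phi>"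
    and sym: "\<And>is i j. iter_partial (i # j # is) \<phi> = iter_partial (j # i # is) \<phi>"
  shows "\<exists>P A. (\<forall>t. (P has_real_derivative A t) (at t)) \<and> (\<forall>s t. u s = u t \<longrightarrow> P s = P t) \<and>
    (\<forall>t. (\<integral>x. CARD('n) * (cmod (conv (u t) \<phi> x))\<^sup>2
           - (norm x * cmod (conv (\<lambda>y. log_nonlin (u t y)) \<phi> x - log_nonlin (conv (u t) \<phi> x)))\<^sup>2 / 2
           - CARD('n) * (cmod (conv (\<lambda>y. log_nonlin (u t y)) \<phi> x - log_nonlin (conv (u t) \<phi> x)) * cmod (conv (u t) \<phi> x)) \<partial>lborel) \<le> A t)"
proof -
  define g where "g t y = log_nonlin (u t y)" for t y
  define D where "D is = iter_partial is \<phi>" for "is"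
  have D_test: "test_fun (D is)" for "is"
    unfolding D_def by (induction "is") (auto intro: \<phi> test_fun_partial_deriv)
  have D_Cons: "partial_deriv i (D is) = D (i # is)" for i "is" by (simp add: D_def)
  have D_sym: "D (i # j # is) = D (j # i # is)" for i j "is" unfolding D_def by (rule sym)
  have decg: "decays g" unfolding g_def by (rule decays_log_nonlin[OF dec])
  have u_meas: "u t \<in> borel_measurable borel" for t
    by (intro borel_measurable_continuous_onI smooth_continuous sm)
  have g_meas: "g t \<in> borel_measurable borel" for t
    unfolding g_def using continuous_on_compose2[OF continuous_on_log_nonlin smooth_continuous[OF sm]]
    by (intro borel_measurable_continuous_onI) auto
  have u_int: "integrable lborel (u t)" and g_int: "integrable lborel (g t)" for t
    using decays_integrable[OF dec] decays_integrable[OF decg] u_meas g_meas by auto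
  \<comment> \<open>Lists index derivatives: \<open>U is\<close> and \<open>W is\<close> are the
    derivatives of the mollified solution and of the mollified nonlinearity, taken on the kernel,
    and \<open>Q is\<close> is the same derivative of Laplacian v - w.\<close>
  define U where "U is t = conv (u t) (D is)" for "is" t
  define W where "W is t = conv (g t) (D is)" for "is" t
  define Q where "Q is t x = (\<Sum>j\<in>UNIV. U (j # j # is) t x) - W is t x" for "is" t x
  have U_dec: "decays (U is)" and W_dec: "decays (W is)" for "is"
    unfolding U_def W_def by (intro decays_conv_fixed dec decg D_test)+
  have Q_dec: "decays (Q is)" for "is"
    unfolding Q_def by (intro decays_diff decays_sum U_dec W_dec)
  have U_meas [measurable]: "U is t \<in> borel_measurable borel" and W_meas [measurable]: "W is t \<in> borel_measurable borel" for "is" t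
    unfolding U_def W_def by (intro borel_measurable_conv u_meas g_meas borel_measurable_test_fun D_test)+
  have Q_meas [measurable]: "Q is t \<in> borel_measurable borel" for "is" t
    unfolding Q_def by measurable
  have U_der: "((\<lambda>h. U is t (x + h *\<^sub>R axis i 1)) has_vector_derivative U (i # is) t x) (at 0)"
    and W_der: "((\<lambda>h. W is t (x + h *\<^sub>R axis i 1)) has_vector_derivative W (i # is) t x) (at 0)" for "is" i t x
    unfolding U_def W_def D_Cons[symmetric]
    by (intro has_vector_derivative_conv u_int g_int D_test)+
  have Q_der: "((\<lambda>h. Q is t (x + h *\<^sub>R axis i 1)) has_vector_derivative Q (i # is) t x) (at 0)" for "is" i t x
  proof -
    \<comment> \<open>The symmetry exchanges the two outermost directions only, so moving
      \<open>i\<close> past both copies of \<open>j\<close> takes two exchanges, the first one under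
      a further derivative.\<close>
    have "U (j # j # i # is) = U (i # j # j # is)" for j
      unfolding U_def by (metis D_Cons D_sym)
    then have "Q (i # is) t x = (\<Sum>j\<in>UNIV. U (i # j # j # is) t x) - W (i # is) t x"
      by (simp add: Q_def)
    then show ?thesis
      unfolding Q_def by (auto intro!: has_vector_derivative_diff has_vector_derivative_sum U_der W_der)
  qed
  have g_eq: "g t = (\<lambda>y. log_nonlin (u t y))" for t by (simp add: g_def fun_eq_iff)
  have U_time: "((\<lambda>s. U is s x) has_vector_derivative \<i> * Q is t x) (at t)" for "is" t x
    using has_vector_derivative_conv_time[OF wt eq sm _ D_test[of "is"], where x = x and t = t] g_int
    by (simp add: U_def Q_def W_def g_eq D_Cons)

  \<comment> \<open>Since Re (-i z) = Im z, this is the density Im (cnj v (x . grad v)). The factor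
    -i cancels the i in v_t = i q, which gives the form of \<open>p'\<close>.\<close>
  define p where "p t x = (\<Sum>i\<in>UNIV. x $ i * Re (- \<i> * U [i] t x * cnj (U [] t x)))" for t x
  define p' where "p' t x = (\<Sum>i\<in>UNIV. x $ i * (Re (Q [i] t x * cnj (U [] t x)) - Re (Q [] t x * cnj (U [i] t x))))" for t x
  define P where "P t = (\<integral>x. p t x \<partial>lborel)" for t
  define A where "A t = (\<integral>x. p' t x \<partial>lborel)" for t
  have p_der: "((\<lambda>s. p s x) has_vector_derivative p' t x) (at t)" for t x
  proof -
    have "((\<lambda>s. Re (- \<i> * U [i] s x * cnj (U [] s x))) has_vector_derivative
       Re (Q [i] t x * cnj (U [] t x)) - Re (Q [] t x * cnj (U [i] t x))) (at t)" for i
      using has_vector_derivative_Re_mult_cnj[OF has_vector_derivative_mult_right[OF U_time, of "- \<i>"] U_time]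
      by (rule has_vector_derivative_eq_rhs) (simp add: algebra_simps)
    then show ?thesis
      unfolding p_def p'_def by (intro has_vector_derivative_sum has_vector_derivative_mult_right)
  qed
  have [measurable]: "cnj \<in> borel_measurable borel" "(\<lambda>x::real^'n. x $ i) \<in> borel_measurable borel" for i
    by (intro borel_measurable_continuous_onI continuous_intros)+
  have p_dec: "decays p"
    unfolding p_def
  proof (intro decays_sum decays_coord_real decays_Re_mult_cnj U_dec)
    show "decays (\<lambda>t x. - \<i> * U [i] t x)" for i
      by (rule decays_mono[OF U_dec[of "[i]"], of _ 1]) (simp add: norm_mult)
  qed
  have p'_dec: "decays p'"
    unfolding p'_def by (intro decays_sum decays_coord_real decays_diff decays_Re_mult_cnj U_dec Q_dec)
  have p_meas: "p t \<in> borel_measurable borel" for t unfolding p_def by measurable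
  obtain K c where K: "c > 0" "\<And>t x. norm (p' t x) \<le> K * exp (- c * norm x)"
    using p'_dec unfolding decays_def by blast
  have "(P has_vector_derivative A t) (at t)" for t
    unfolding P_def[abs_def] A_def
  proof (rule has_vector_derivative_integral_dominated[where e = 1])
    show "integrable lborel (\<lambda>x::real^'n. K * exp (- c * norm x))"
      by (intro integrable_mult_right integrable_exp_neg_norm K)
    show "integrable lborel (p s)" for s
      using decays_integrable[OF p_dec] p_meas by simp
  qed (use p_der K(2) in auto)
  then have 1: "(P has_real_derivative A t) (at t)" for t
    by (simp add: has_real_derivative_iff_has_vector_derivative)
  have 2: "P s = P t" if "u s = u t" for s t
    using that by (simp add: P_def p_def U_def)
  have 3: "(\<integral>x. CARD('n) * (cmod (U [] t x))\<^sup>2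
           - (norm x * cmod (W [] t x - log_nonlin (U [] t x)))\<^sup>2 / 2
           - CARD('n) * (cmod (W [] t x - log_nonlin (U [] t x)) * cmod (U [] t x)) \<partial>lborel) \<le> A t" for t
    unfolding A_def p'_def
  proof (rule virial_lower_bound[where v = "U []" and w = "W []" and ?v1.0 = "\<lambda>i. U [i]" and ?q1.0 = "\<lambda>i. Q [i]"
        and ?v2.0 = "\<lambda>i j. U [i, j]" and q = "Q []"])
    show "decays (\<lambda>p x. log_nonlin (U [] p x))" by (rule decays_log_nonlin[OF U_dec])
    show "U [i, j] = U [j, i]" for i j unfolding U_def using D_sym[of i j "[]"] by simp
    show "Q [] p x = (\<Sum>j\<in>UNIV. U [j, j] p x) - W [] p x" for p x by (simp add: Q_def)
  qed (intro U_dec W_dec Q_dec U_der Q_der U_meas W_meas Q_meas)+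
  have D_Nil: "D [] = \<phi>" by (simp add: D_def)
  show ?thesis
    using 1 2 3 unfolding U_def W_def D_Nil g_eq by blast
qed

theorem theorem4p7:
  shows "\<not> (\<exists>u :: real \<Rightarrow> real^'n::finite \<Rightarrow> complex. log_nls_solution u \<and> breather_profile u)"
proof
  assume "\<exists>u :: real \<Rightarrow> real^'n \<Rightarrow> complex. log_nls_solution u \<and> breather_profile u"
  then obtain u :: "real \<Rightarrow> real^'n \<Rightarrow> complex" where sol: "log_nls_solution u" and br: "breather_profile u" by blast
  obtain ut where wt: "weak_time_deriv u ut" and eq: "\<And>t x. \<i> * ut t x + laplacian (u t) x = log_nonlin (u t x)"
    using sol unfolding log_nls_solution_def by blast
  obtain t0 x0 where u0: "u t0 x0 \<noteq> 0" using br unfolding breather_profile_def by blast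
  obtain \<tau> C \<gamma> :: real and \<alpha>max :: nat where \<tau>: "\<tau> > 0" and C: "C > 0" "\<gamma> > 0"
    and per: "\<And>t x. u (t + \<tau>) x = u t x" and sm: "\<And>t. smooth (u t)"
    and bd: "\<And>x is t. length is \<le> \<alpha>max \<Longrightarrow> cmod (iter_partial is (u t) x) \<le> C * exp (- \<gamma> * norm x)"
    using br unfolding breather_profile_def by blast
  have dec: "decays u"
    by (rule decaysI[OF C(2)]) (use bd[of "[]"] in simp)
  define g where "g t y = log_nonlin (u t y)" for t y
  have g_eq: "g t = (\<lambda>y. log_nonlin (u t y))" for t by (simp add: g_def fun_eq_iff)
  have decg: "decays g" unfolding g_def by (rule decays_log_nonlin[OF dec])
  have u_cont: "continuous_on UNIV (u t)" for t by (intro smooth_continuous sm)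
  have g_cont: "continuous_on UNIV (g t)" for t
    unfolding g_def using continuous_on_compose2[OF continuous_on_log_nonlin u_cont] by auto
  have [measurable]: "u t \<in> borel_measurable borel" "g t \<in> borel_measurable borel" for t
    by (intro borel_measurable_continuous_onI u_cont g_cont)+
  have u_int: "integrable lborel (u t)" and g_int: "integrable lborel (g t)" for t
    using decays_integrable[OF dec] decays_integrable[OF decg] by auto

  define \<delta> where "\<delta> k = inverse (real (Suc k))" for k
  have "\<exists>\<phi>::real^'n \<Rightarrow> complex. mollifier (\<delta> k) \<phi>" for k
    by (rule exists_mollifier) (simp add: \<delta>_def)
  then obtain \<Phi> :: "nat \<Rightarrow> real^'n \<Rightarrow> complex" where \<Phi>: "\<And>k. mollifier (\<delta> k) (\<Phi> k)" by metis
  have \<delta>: "\<delta> \<longlonglongrightarrow> 0" unfolding \<delta>_def by (rule LIMSEQ_inverse_real_of_nat)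
  have \<Phi>_test: "test_fun (\<Phi> k)" and \<Phi>_supp: "norm x > \<delta> k \<Longrightarrow> \<Phi> k x = 0"
    and \<Phi>_one: "(\<integral>x. cmod (\<Phi> k x) \<partial>lborel) = 1"
    and \<Phi>_sym: "iter_partial (i # j # is) (\<Phi> k) = iter_partial (j # i # is) (\<Phi> k)" for k x i j "is"
    using \<Phi>[of k] unfolding mollifier_def by blast+
  \<comment> \<open>All radii are at most 1, so the decay lemma for convolutions applies with R = 1
    and mass bound 1 for every \<open>k\<close> at once.\<close>
  have \<Phi>_supp1: "\<Phi> k x = 0" if "norm x > 1" for k x
  proof (rule \<Phi>_supp)
    have "\<delta> k \<le> 1" unfolding \<delta>_def by (simp add: inverse_le_1_iff)
    then show "norm x > \<delta> k" using that by linarith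
  qed
  have u_lim: "(\<lambda>k. conv (u t) (\<Phi> k) x) \<longlonglongrightarrow> u t x" for t x
    by (rule conv_mollifier_tendsto[OF u_int _ \<Phi> \<delta>]) (use u_cont in \<open>simp add: continuous_on_eq_continuous_at\<close>)
  have g_lim: "(\<lambda>k. conv (g t) (\<Phi> k) x) \<longlonglongrightarrow> g t x" for t x
    by (rule conv_mollifier_tendsto[OF g_int _ \<Phi> \<delta>]) (use g_cont in \<open>simp add: continuous_on_eq_continuous_at\<close>)

  let ?n = "real CARD('n)"
  \<comment> \<open>The parameter is the pair of time and mollification index, so decay of these
    families means one dominating exponential for all of them. It bounds \<open>lo\<close> and
    justifies the limit in \<open>k\<close>.\<close>
  define v where "v = (\<lambda>tk :: real \<times> nat. conv (u (fst tk)) (\<Phi> (snd tk)))"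
  define d where "d = (\<lambda>(tk :: real \<times> nat) x. conv (g (fst tk)) (\<Phi> (snd tk)) x - log_nonlin (v tk x))"
  define G where "G = (\<lambda>tk x. ?n * (norm (v tk x))\<^sup>2 - (norm x * norm (d tk x))\<^sup>2 / 2 - ?n * (norm (d tk x) * norm (v tk x)))"
  have v_dec: "decays v"
    unfolding v_def by (rule decays_conv[OF dec, of 1 _ 1]) (auto simp: \<Phi>_supp1 \<Phi>_test \<Phi>_one)
  have w_dec: "decays (\<lambda>tk :: real \<times> nat. conv (g (fst tk)) (\<Phi> (snd tk)))"
    by (rule decays_conv[OF decg, of 1 _ 1]) (auto simp: \<Phi>_supp1 \<Phi>_test \<Phi>_one)
  have d_dec: "decays d"
    unfolding d_def by (intro decays_diff w_dec decays_log_nonlin v_dec)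
  have G_dec: "decays G" unfolding G_def by (rule decays_virial_bound[OF v_dec d_dec])
  have [measurable]: "log_nonlin \<in> borel_measurable borel"
    by (intro borel_measurable_continuous_onI continuous_on_log_nonlin)
  have v_meas [measurable]: "v tk \<in> borel_measurable borel"
    and w_meas [measurable]: "conv (g (fst tk)) (\<Phi> (snd tk)) \<in> borel_measurable borel" for tk
    unfolding v_def by (rule borel_measurable_conv; use borel_measurable_test_fun[OF \<Phi>_test] in measurable)+
  have [measurable]: "d tk \<in> borel_measurable borel" for tk unfolding d_def by measurable
  have G_meas: "G tk \<in> borel_measurable borel" for tk unfolding G_def by measurable
  obtain K c where K: "c > 0" "\<And>tk x. norm (G tk x) \<le> K * exp (- c * norm x)"
    using G_dec unfolding decays_def by blast
  have K_int: "integrable lborel (\<lambda>x::real^'n. K * exp (- c * norm x))"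
    by (intro integrable_mult_right integrable_exp_neg_norm K)
  define lo where "lo k t = (\<integral>x. G (t, k) x \<partial>lborel)" for k t
  define m where "m t = (\<integral>x. ?n * (cmod (u t x))\<^sup>2 \<partial>lborel)" for t
  have G_lim: "(\<lambda>k. G (t, k) x) \<longlonglongrightarrow> ?n * (cmod (u t x))\<^sup>2" for t x
  proof -
    have v_lim: "(\<lambda>k. v (t, k) x) \<longlonglongrightarrow> u t x" using u_lim by (simp add: v_def)
    then have "(\<lambda>k. log_nonlin (v (t, k) x)) \<longlonglongrightarrow> log_nonlin (u t x)"
      by (rule isCont_tendsto_compose[OF isCont_log_nonlin])
    then have "(\<lambda>k. d (t, k) x) \<longlonglongrightarrow> g t x - log_nonlin (u t x)"
      unfolding d_def using g_lim by (intro tendsto_diff) auto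
    then have d_lim: "(\<lambda>k. d (t, k) x) \<longlonglongrightarrow> 0" by (simp add: g_def)
    have "(\<lambda>k. G (t, k) x) \<longlonglongrightarrow> ?n * (norm (u t x))\<^sup>2 - (norm x * norm (0::complex))\<^sup>2 / 2 - ?n * (norm (0::complex) * norm (u t x))"
      unfolding G_def by (intro tendsto_intros v_lim d_lim) auto
    then show ?thesis by simp
  qed
  have m_int: "integrable lborel (\<lambda>x. ?n * (cmod (u t x))\<^sup>2)" for t
    by (rule integrable_dominated_convergence[OF _ _ K_int, where s = "\<lambda>k. G (t, k)"]) (use G_lim G_meas K(2) in auto)
  have lo_lim: "(\<lambda>k. lo k t) \<longlonglongrightarrow> m t" for t
    unfolding lo_def m_def
    by (rule integral_dominated_convergence[OF _ _ K_int]) (use G_lim G_meas K(2) in auto)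
  have lo_bd: "\<bar>lo k t\<bar> \<le> (\<integral>x. K * exp (- c * norm (x::real^'n)) \<partial>lborel)" for k t
    unfolding lo_def real_norm_def[symmetric]
    by (rule Bochner_Integration.integral_norm_bound_integral[OF _ K_int]) (use K(2) decays_integrable[OF G_dec] G_meas in auto)
  have m_nonneg: "m t \<ge> 0" for t unfolding m_def by simp

  \<comment> \<open>Continuity in time is taken from a mollification. Some index \<open>k0\<close>
    detects that u(t0) is nonzero at \<open>x0\<close>; the value stays nonzero for nearby times,
    when \<open>u t\<close> therefore cannot vanish identically.\<close>
  have "eventually (\<lambda>k. conv (u t0) (\<Phi> k) x0 \<noteq> 0) sequentially"
    using tendsto_imp_eventually_ne[OF u_lim u0] .
  then obtain k0 where k0: "conv (u t0) (\<Phi> k0) x0 \<noteq> 0"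
    by (auto simp: eventually_sequentially)
  have "isCont (\<lambda>s. conv (u s) (\<Phi> k0) x0) t0"
    using has_vector_derivative_conv_time[OF wt eq sm g_int[unfolded g_def] \<Phi>_test[of k0], where x = x0 and t = t0]
    by (rule has_vector_derivative_continuous)
  from continuous_at_avoid[OF this k0] obtain e where e: "e > 0"
    and ne: "\<And>s. dist t0 s < e \<Longrightarrow> conv (u s) (\<Phi> k0) x0 \<noteq> 0" by metis
  have m_pos: "m t > 0" if "\<bar>t - t0\<bar> < e" for t
  proof -
    have "\<exists>x. u t x \<noteq> 0"
    proof (rule ccontr)
      assume "\<nexists>x. u t x \<noteq> 0"
      then have "conv (u t) (\<Phi> k0) x0 = 0" by (simp add: conv_def)
      then show False using ne[of t] that by (simp add: dist_real_def abs_minus_commute)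
    qed
    then obtain x where "u t x \<noteq> 0" by blast
    then show ?thesis
      unfolding m_def using m_int u_cont
      by (intro integral_pos_continuous[of _ x]) (auto intro!: continuous_intros)
  qed

  have "\<exists>P A. (\<forall>t. (P has_real_derivative A t) (at t)) \<and> (\<forall>s t. u s = u t \<longrightarrow> P s = P t) \<and> (\<forall>t. lo k t \<le> A t)" for k
    using virial_monotonicity[OF wt eq sm dec \<Phi>_test[of k] \<Phi>_sym[of _ _ _ k]]
    unfolding lo_def G_def d_def v_def g_eq fst_conv snd_conv .
  then obtain P A where "\<And>k. (\<forall>t. (P k has_real_derivative A k t) (at t)) \<and>
      (\<forall>s t. u s = u t \<longrightarrow> P k s = P k t) \<and> (\<forall>t. lo k t \<le> A k t)" by metis
  then have P: "\<And>k t. (P k has_real_derivative A k t) (at t)"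
    and P_u: "\<And>k s t. u s = u t \<Longrightarrow> P k s = P k t" and A: "\<And>k t. lo k t \<le> A k t" by blast+
  have "u (t0 + \<tau>) = u t0" using per by (simp add: fun_eq_iff)
  from periodic_derivative_liminf[OF \<tau> P P_u[OF this] A lo_bd lo_lim m_nonneg e m_pos]
  show False .
qed

end
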